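(* Let $\sigma\notin\mathbb{Q}$ be a complex parameter with $|\mathrm{Re}\,\sigma|\notin\frac12+\mathbb{Z}$, and let $\vec\theta=(\theta_0,\theta_t,\theta_1,\theta_\infty)$ be the complex parameters of the Painlevé VI equation. By the absolute convergence of the series for the Painlevé VI tau function $$\tau_{\mathrm{VI}}(t)=\mathrm{const}\cdot t^{-\theta_0^2-\theta_t^2}\sum_{n\in\mathbb{Z}}e^{in\eta}\,\mathscr{B}(\vec\theta,\sigma+n;t),$$ the convergence of the ($c=1$) conformal block function $$\mathscr{B} \left( \vec{\theta},\sigma ;t\right)=\mathscr{N}^{\theta_1}_{\theta_\infty ,\sigma}\, \mathscr{N}^{\theta_t}_{\sigma ,\theta_0}\,t^{\sigma^2}(1-t)^{2 \theta_t \theta_1} \sum_{\lambda ,\mu \in \mathbb{Y}} \mathscr{B}_{\lambda ,\mu}\left( \vec{\theta} ,\sigma \right) t^{\left| \lambda \right|+\left| \mu \right|}$$ also follows, since it is a partial sum of the $\tau$ series.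
   Context: Here $\eta$ is an arbitrary complex parameter. Convergence is that of the tau series, in a domain in $\mathbb{C}\setminus\{0\}$ containing a neighborhood of $0$. $\mathbb{Y}$ is the set of all Young diagrams; $|\lambda|$ is the number of cells of $\lambda$; $\lambda_i$ is the length of the $i$-th row; $\lambda'$ is the conjugate diagram of $\lambda$; $h_\lambda(i,j)$ is the hook length of the cell $(i,j)$ of $\lambda$. The coefficients are $$\mathscr{B}_{\lambda ,\mu} ( \vec{\theta} , \sigma )=\prod_{(i,j)\in \lambda}\frac{\left( (\theta_t+\sigma+i-j)^2-\theta_0^2 \right) \left( (\theta_1+\sigma+i-j)^2-\theta_\infty^2 \right)}{h_\lambda^2(i,j)\left( \lambda_j' -i+\mu_i-j+1+2 \sigma \right)^2}\prod_{(i,j)\in \mu}\frac{\left( (\theta_t-\sigma+i-j)^2-\theta_0^2 \right) \left( (\theta_1-\sigma+i-j)^2-\theta_\infty^2 \right)}{h_\mu^2(i,j)\left( \mu_j' -i+\lambda_i-j+1-2 \sigma \right)^2},$$ and $$\mathscr{N}^{\theta_2}_{\theta_3,\theta_1}=\frac{\prod_{\varepsilon =\pm} G(1+\theta_3+\varepsilon (\theta_1+\theta_2))\,G(1-\theta_3+\varepsilon (\theta_1-\theta_2))}{G(1-2 \theta_1)\,G(1-2 \theta_2)\,G(1+2 \theta_3)},$$ where $G$ is the Barnes $G$-function, satisfying $G(1)=1$, $G(z+1)=\Gamma(z)G(z)$. *)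

theory Defs
  imports "HOL-Analysis.Analysis"
begin

text \<open>
  Young diagrams are finite sets of cells (i, j), with row index i and column index j both
  starting at 1, closed under decreasing either index.
\<close>

definition young_diagrams :: "(nat \<times> nat) set set" where
  "young_diagrams =
    {lam. finite lam \<and> lam \<subseteq> {1..} \<times> {1..} \<and>
         (\<forall>(i, j) \<in> lam. {1..i} \<times> {1..j} \<subseteq> lam)}"

definition conjugate :: "(nat \<times> nat) set \<Rightarrow> (nat \<times> nat) set" where
  "conjugate lam = prod.swap ` lam"

definition row_length :: "(nat \<times> nat) set \<Rightarrow> nat \<Rightarrow> nat" where
  "row_length lam i = card {j. (i, j) \<in> lam}"

definition hook_length :: "(nat \<times> nat) set \<Rightarrow> nat \<Rightarrow> nat \<Rightarrow> int" where
  "hook_length lam i j =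
     int (row_length lam i) - int j + int (row_length (conjugate lam) j) - int i + 1"

text \<open>
  The Barnes function by its Weierstrass product, with \<open>z = 1 + w\<close>. It is the entire function
  with \<open>G 1 = 1\<close> and \<open>G (z + 1) = \<Gamma> z * G z\<close> that is usually meant; these two equations
  alone do not determine it.
\<close>

definition Barnes_G :: "complex \<Rightarrow> complex" where
  "Barnes_G z =
    (let w = z - 1 in
       of_real (2 * pi) powr (w / 2) * exp (- (w + w\<^sup>2 * (1 + euler_mascheroni)) / 2) *
       (\<Prod>k. (1 + w / of_nat (Suc k)) ^ Suc k * exp (w\<^sup>2 / (2 * of_nat (Suc k)) - w)))"

text \<open>
  \<open>structure_const \<theta>2 \<theta>3 \<theta>1\<close> has upper index \<open>\<theta>2\<close> and lower indices
  \<open>\<theta>3, \<theta>1\<close>. It is 0 where the denominator vanishes, which for the arguments used in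
  \<open>conformal_block\<close> depends on \<open>\<theta>0, \<theta>t, \<theta>1, \<theta>\<infinity>\<close> only as long as
  \<open>2\<sigma>\<close> is not an integer.
\<close>

definition structure_const :: "complex \<Rightarrow> complex \<Rightarrow> complex \<Rightarrow> complex" where
  "structure_const \<theta>2 \<theta>3 \<theta>1 =
    (\<Prod>\<epsilon>\<in>{1, -1}. Barnes_G (1 + \<theta>3 + \<epsilon> * (\<theta>1 + \<theta>2)) *
                  Barnes_G (1 - \<theta>3 + \<epsilon> * (\<theta>1 - \<theta>2))) /
    (Barnes_G (1 - 2 * \<theta>1) * Barnes_G (1 - 2 * \<theta>2) * Barnes_G (1 + 2 * \<theta>3))"

definition block_coeff ::
  "complex \<Rightarrow> complex \<Rightarrow> complex \<Rightarrow> complex \<Rightarrow> complex \<Rightarrow>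
   (nat \<times> nat) set \<Rightarrow> (nat \<times> nat) set \<Rightarrow> complex" where
  "block_coeff \<theta>0 \<theta>t \<theta>1 \<theta>inf \<sigma> lam mu =
    (\<Prod>(i, j)\<in>lam.
       ((\<theta>t + \<sigma> + of_nat i - of_nat j)\<^sup>2 - \<theta>0\<^sup>2) *
       ((\<theta>1 + \<sigma> + of_nat i - of_nat j)\<^sup>2 - \<theta>inf\<^sup>2) /
       ((of_int (hook_length lam i j))\<^sup>2 *
        (of_nat (row_length (conjugate lam) j) - of_nat i + of_nat (row_length mu i) - of_nat j
           + 1 + 2 * \<sigma>)\<^sup>2)) *
    (\<Prod>(i, j)\<in>mu.
       ((\<theta>t - \<sigma> + of_nat i - of_nat j)\<^sup>2 - \<theta>0\<^sup>2) *
       ((\<theta>1 - \<sigma> + of_nat i - of_nat j)\<^sup>2 - \<theta>inf\<^sup>2) /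
       ((of_int (hook_length mu i j))\<^sup>2 *
        (of_nat (row_length (conjugate mu) j) - of_nat i + of_nat (row_length lam i) - of_nat j
           + 1 - 2 * \<sigma>)\<^sup>2))"

text \<open>
  The block and the tau series are multivalued around \<open>t = 0\<close>. They are taken as functions of
  a logarithm \<open>L\<close> of \<open>t\<close>, so \<open>t = exp L\<close> and the power of \<open>t\<close> with
  exponent \<open>a\<close> is \<open>exp (a * L)\<close>; every branch is obtained by varying \<open>L\<close>.
\<close>

definition block_prefactor ::
  "complex \<Rightarrow> complex \<Rightarrow> complex \<Rightarrow> complex \<Rightarrow> complex \<Rightarrow> complex \<Rightarrow> complex" where
  "block_prefactor \<theta>0 \<theta>t \<theta>1 \<theta>inf \<sigma> L =
    structure_const \<theta>1 \<theta>inf \<sigma> * structure_const \<theta>t \<sigma> \<theta>0 *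
    exp (\<sigma>\<^sup>2 * L) * (1 - exp L) powr (2 * \<theta>t * \<theta>1)"

definition block_series_term ::
  "complex \<Rightarrow> complex \<Rightarrow> complex \<Rightarrow> complex \<Rightarrow> complex \<Rightarrow> complex \<Rightarrow>
   (nat \<times> nat) set \<times> (nat \<times> nat) set \<Rightarrow> complex" where
  "block_series_term \<theta>0 \<theta>t \<theta>1 \<theta>inf \<sigma> L =
    (\<lambda>(lam, mu). block_coeff \<theta>0 \<theta>t \<theta>1 \<theta>inf \<sigma> lam mu * exp L ^ (card lam + card mu))"

definition conformal_block ::
  "complex \<Rightarrow> complex \<Rightarrow> complex \<Rightarrow> complex \<Rightarrow> complex \<Rightarrow> complex \<Rightarrow> complex" where
  "conformal_block \<theta>0 \<theta>t \<theta>1 \<theta>inf \<sigma> L =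
    block_prefactor \<theta>0 \<theta>t \<theta>1 \<theta>inf \<sigma> L *
    (\<Sum>\<^sub>\<infinity>p \<in> young_diagrams \<times> young_diagrams. block_series_term \<theta>0 \<theta>t \<theta>1 \<theta>inf \<sigma> L p)"

text \<open>
  The terms of the tau series, with \<open>\<kappa>\<close> the arbitrary constant factor: first indexed by
  \<open>n\<close> only, then with the block expanded, indexed by \<open>(n, lam, mu)\<close>. The block series
  is, up to its prefactor, the part of the second family with \<open>n = 0\<close>.
\<close>

definition tau_factor ::
  "complex \<Rightarrow> complex \<Rightarrow> complex \<Rightarrow> complex \<Rightarrow> int \<Rightarrow> complex \<Rightarrow> complex" where
  "tau_factor \<kappa> \<theta>0 \<theta>t \<eta> n L =
    \<kappa> * exp ((- \<theta>0\<^sup>2 - \<theta>t\<^sup>2) * L) * exp (\<i> * of_int n * \<eta>)"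

definition tau_term ::
  "complex \<Rightarrow> complex \<Rightarrow> complex \<Rightarrow> complex \<Rightarrow> complex \<Rightarrow> complex \<Rightarrow> complex \<Rightarrow> complex \<Rightarrow>
   int \<Rightarrow> complex" where
  "tau_term \<kappa> \<theta>0 \<theta>t \<theta>1 \<theta>inf \<sigma> \<eta> L n =
    tau_factor \<kappa> \<theta>0 \<theta>t \<eta> n L * conformal_block \<theta>0 \<theta>t \<theta>1 \<theta>inf (\<sigma> + of_int n) L"

definition tau_expanded_term ::
  "complex \<Rightarrow> complex \<Rightarrow> complex \<Rightarrow> complex \<Rightarrow> complex \<Rightarrow> complex \<Rightarrow> complex \<Rightarrow> complex \<Rightarrow>
   int \<times> (nat \<times> nat) set \<times> (nat \<times> nat) set \<Rightarrow> complex" where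
  "tau_expanded_term \<kappa> \<theta>0 \<theta>t \<theta>1 \<theta>inf \<sigma> \<eta> L =
    (\<lambda>(n, p). tau_factor \<kappa> \<theta>0 \<theta>t \<eta> n L *
       (block_prefactor \<theta>0 \<theta>t \<theta>1 \<theta>inf (\<sigma> + of_int n) L *
        block_series_term \<theta>0 \<theta>t \<theta>1 \<theta>inf (\<sigma> + of_int n) L p))"

end

theory Submission
  imports Defs "HOL-Complex_Analysis.Weierstrass_Factorization"
begin

text \<open>
  The point is a bound on the coefficients which is uniform in the shift of \<open>\<sigma>\<close>:
  \<open>\<bar>block_coeff (\<sigma> + n) lam mu\<bar> \<le> K ^ (\<bar>lam\<bar> + \<bar>mu\<bar>) * exp (8 n\<^sup>2)\<close>. Up to such factors every linear
  factor of the coefficient may be replaced by \<open>1 + \<bar>m\<bar>\<close> with \<open>m\<close> its integer part, because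
  \<open>2\<sigma>\<close> has positive distance to the integers. The logarithm of the resulting product is linear
  in the cell contents minus a quadratic form in them whose kernel is the second difference of
  \<open>ln (1 + \<bar>m\<bar>)\<close>. This kernel is diagonally dominant, hence positive semidefinite; completing the
  square with a tent of height \<open>\<bar>n\<bar>\<close> leaves only its energy, which is \<open>O(n\<^sup>2)\<close>.

  The Barnes functions in the structure constants are compared with superfactorials by the functional
  equation; the leading growth cancels, so the structure constants are \<open>exp (O(n\<^sup>2))\<close>. As
  \<open>\<bar>t powr (\<sigma> + n)\<^sup>2\<bar>\<close> is \<open>\<bar>t\<bar> powr n\<^sup>2\<close> up to \<open>exp (O(n))\<close>, and there are at most \<open>2 ^ N\<close> diagrams of
  size \<open>N\<close>, the expanded series converges absolutely for small \<open>\<bar>t\<bar>\<close>.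
\<close>

section \<open>Arms, legs and contents of pairs of Young diagrams\<close>

text \<open>A cell-by-cell estimate is impossible. For a single row of length k in
  \<open>lam\<close>, with \<open>mu\<close> having the same first row, the last cell has hook
  length 1 and a bounded mixed denominator, while its numerator has size k^4. Numerators and
  denominators balance only over the whole pair of diagrams, hence the passage to an energy.

  The tent is dictated by the shift. Adding n to \<sigma> moves the contents in the numerators by n,
  the mixed denominators by 2n and the hook lengths not at all. At a shifted content x the linear
  terms then differ by K(x + n) + K(x - n) - 2 K(x), with K the logarithmic kernel, and this is the
  convolution of the second difference of K with a tent of height |n|. For n = 0 the difference
  vanishes and positivity alone suffices.

  No sharp constant is sought: every loss has the form exp(O(n^2)) or a power of the number of
  cells, and a smaller |t| pays for both, the first through |t|^(n^2), the second through the powers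
  of t in the block.\<close>

lemma young_diagrams_finite: "lam \<in> young_diagrams \<Longrightarrow> finite lam"
  by (auto simp: young_diagrams_def)

lemma young_diagrams_down:
  assumes "lam \<in> young_diagrams" "(i, j) \<in> lam" "1 \<le> i'" "i' \<le> i" "1 \<le> j'" "j' \<le> j"
  shows "(i', j') \<in> lam"
  using assms unfolding young_diagrams_def by fastforce

lemma young_diagrams_pos:
  assumes "lam \<in> young_diagrams" "(i, j) \<in> lam"
  shows "1 \<le> i" "1 \<le> j"
  using assms unfolding young_diagrams_def by auto

lemma conjugate_iff: "(j, i) \<in> conjugate lam \<longleftrightarrow> (i, j) \<in> lam"
  by (force simp: conjugate_def image_iff)

lemma conjugate_young_diagrams:
  assumes "lam \<in> young_diagrams" shows "conjugate lam \<in> young_diagrams"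
proof -
  have "finite (conjugate lam)"
    using assms by (simp add: conjugate_def young_diagrams_finite)
  moreover have "(i', j') \<in> conjugate lam"
    if "(i, j) \<in> conjugate lam" "i' \<in> {1..i}" "j' \<in> {1..j}" for i j i' j'
    using that young_diagrams_down[OF assms, of j i j' i'] by (auto simp: conjugate_iff)
  moreover have "conjugate lam \<subseteq> {1..} \<times> {1..}"
    using young_diagrams_pos[OF assms] by (auto simp: conjugate_def)
  ultimately show ?thesis
    unfolding young_diagrams_def by auto
qed

lemma row_length_conjugate: "row_length (conjugate lam) j = card {i. (i, j) \<in> lam}"
  by (simp add: row_length_def conjugate_iff)

lemma nat_initial_segment:
  fixes S :: "nat set"
  assumes "finite S" "\<And>x. x \<in> S \<Longrightarrow> 1 \<le> x" "\<And>x y. x \<in> S \<Longrightarrow> 1 \<le> y \<Longrightarrow> y \<le> x \<Longrightarrow> y \<in> S"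
  shows "S = {1..card S}"
proof (cases "S = {}")
  case False
  have "S = {1..Max S}"
  proof
    show "S \<subseteq> {1..Max S}"
      using assms(1,2) by auto
    show "{1..Max S} \<subseteq> S"
      using assms(3)[OF Max_in[OF assms(1) False]] by auto
  qed
  then show ?thesis
    by (metis card_atLeastAtMost diff_Suc_1)
qed simp

lemma row_eq:
  assumes "lam \<in> young_diagrams"
  shows "{j. (i, j) \<in> lam} = {1..row_length lam i}"
proof -
  have "{j. (i, j) \<in> lam} \<subseteq> snd ` lam"
    by force
  then have "finite {j. (i, j) \<in> lam}"
    using finite_subset young_diagrams_finite[OF assms] by blast
  then show ?thesis
    unfolding row_length_def
    by (rule nat_initial_segment)
       (use young_diagrams_down[OF assms] young_diagrams_pos[OF assms] in blast)+
qed

lemma in_young_diagram_row: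
  assumes "lam \<in> young_diagrams"
  shows "(i, j) \<in> lam \<longleftrightarrow> 1 \<le> j \<and> j \<le> row_length lam i"
  using row_eq[OF assms, of i] by auto

lemma in_young_diagram_column:
  assumes "lam \<in> young_diagrams"
  shows "(i, j) \<in> lam \<longleftrightarrow> 1 \<le> i \<and> i \<le> row_length (conjugate lam) j"
  using in_young_diagram_row[OF conjugate_young_diagrams[OF assms], of j i]
  by (simp add: conjugate_iff)

text \<open>The last cell of the last row: nothing lies below it, so it also ends its column, and
  removing it leaves a diagram.\<close>

lemma corner_exists:
  assumes "lam \<in> young_diagrams" "lam \<noteq> {}"
  obtains p q where "(p, q) \<in> lam" "row_length lam p = q" "row_length (conjugate lam) q = p"
    "lam - {(p, q)} \<in> young_diagrams"
proof -
  define p where "p = Max (fst ` lam)"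
  define q where "q = row_length lam p"
  have fin: "finite lam"
    using assms(1) by (rule young_diagrams_finite)
  have "p \<in> fst ` lam"
    unfolding p_def using fin assms(2) by (intro Max_in) auto
  then obtain j where "(p, j) \<in> lam"
    by auto
  then have pq: "(p, q) \<in> lam"
    unfolding q_def in_young_diagram_row[OF assms(1)] by auto
  have pmax: "i \<le> p" if "(i, j) \<in> lam" for i j
    unfolding p_def using fin that by (intro Max_ge) force+
  have qmax: "j \<le> q" if "(p, j) \<in> lam" for j
    using that unfolding q_def in_young_diagram_row[OF assms(1)] by auto
  have "1 \<le> q"
    using young_diagrams_pos[OF assms(1) pq] by simp
  then have "(i, q) \<in> lam \<longleftrightarrow> i \<in> {1..p}" for i
    using pmax[of i q] young_diagrams_pos[OF assms(1), of i q]
      young_diagrams_down[OF assms(1) pq, of i q] by auto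
  then have "{i. (i, q) \<in> lam} = {1..p}"
    by blast
  then have col: "row_length (conjugate lam) q = p"
    by (simp add: row_length_conjugate)
  have "\<not> (p \<le> i \<and> q \<le> j)" if "(i, j) \<in> lam" "(i, j) \<noteq> (p, q)" for i j
    using that pmax[of i j] qmax[of j] by auto
  then have "{1..i} \<times> {1..j} \<subseteq> lam - {(p, q)}" if "(i, j) \<in> lam - {(p, q)}" for i j
    using that young_diagrams_down[OF assms(1), of i j] by auto
  moreover have "lam \<subseteq> {1..} \<times> {1..}"
    using young_diagrams_pos[OF assms(1)] by auto
  ultimately have "lam - {(p, q)} \<in> young_diagrams"
    using fin unfolding young_diagrams_def by blast
  then show thesis
    using pq col that unfolding q_def by blast
qed

text \<open>Diagrams grow by corners. Recording that the new cell ends its row and its column fixes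
  its own arm and leg and confines all other changes to that row and column.\<close>

lemma young_diagrams_induct [consumes 1, case_names empty insert]:
  assumes "lam \<in> young_diagrams"
    and "P {}"
    and "\<And>lam p q. lam \<in> young_diagrams \<Longrightarrow> (p, q) \<notin> lam \<Longrightarrow>
           insert (p, q) lam \<in> young_diagrams \<Longrightarrow>
           row_length (insert (p, q) lam) p = q \<Longrightarrow>
           row_length (conjugate (insert (p, q) lam)) q = p \<Longrightarrow> P lam \<Longrightarrow> P (insert (p, q) lam)"
  shows "P lam"
  using assms(1)
proof (induction "card lam" arbitrary: lam)
  case 0
  then show ?case
    using assms(2) young_diagrams_finite by auto
next
  case (Suc n)
  then have "lam \<noteq> {}"
    by auto
  then obtain p q where pq: "(p, q) \<in> lam" "row_length lam p = q"
    "row_length (conjugate lam) q = p" "lam - {(p, q)} \<in> young_diagrams"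
    using corner_exists Suc.prems by blast
  have "P (lam - {(p, q)})"
    using Suc pq young_diagrams_finite by (intro Suc.hyps(1)) auto
  then have "P (insert (p, q) (lam - {(p, q)}))"
    using pq Suc.prems by (intro assms(3)) (auto simp: insert_absorb)
  then show ?case
    using pq(1) by (simp add: insert_absorb)
qed

section \<open>Arm-leg numbers of a pair of diagrams and the content identity\<close>

text \<open>The leg is taken in \<open>lam\<close> and the arm in \<open>mu\<close>: this is the
  integer in the mixed denominators. The arm is negative for cells outside \<open>mu\<close>, so the
  value has no definite sign.\<close>

definition arm_leg :: "(nat \<times> nat) set \<Rightarrow> (nat \<times> nat) set \<Rightarrow> nat \<Rightarrow> nat \<Rightarrow> int" where
  "arm_leg lam mu i j =
     int (row_length (conjugate lam) j) - int i + int (row_length mu i) - int j + 1"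

text \<open>Opposite in sign to the customary content, so that it is the integer in the numerators
  of \<open>block_coeff\<close>.\<close>

definition cell_content :: "nat \<times> nat \<Rightarrow> int" where
  "cell_content x = int (fst x) - int (snd x)"

text \<open>In terms of characters this is multiplication by q + 1/q - 2, that is, by minus the
  product of 1 - q and 1 - 1/q.\<close>

definition second_diff :: "(int \<Rightarrow> real) \<Rightarrow> int \<Rightarrow> real" where
  "second_diff F m = F (m + 1) + F (m - 1) - 2 * F m"

lemma arm_leg_self: "arm_leg lam lam i j = hook_length lam i j"
  by (simp add: arm_leg_def hook_length_def)

lemma sum_second_diff_right:
  "(\<Sum>j=1..m. second_diff F (Y + int j)) = F (Y + int m + 1) - F (Y + int m) - F (Y + 1) + F Y"
  by (induction m) (auto simp: second_diff_def algebra_simps)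

lemma sum_second_diff_left:
  assumes "1 \<le> p" "p \<le> r + 1"
  shows "(\<Sum>i=p..r. second_diff F (Y - int i)) =
           F (Y - int p + 1) - F (Y - int p) - F (Y - int r) + F (Y - int r - 1)"
  using assms(2)
proof (induction r)
  case 0
  then show ?case
    using assms(1) by (simp add: le_Suc_eq)
next
  case (Suc r)
  show ?case
  proof (cases "p = Suc r + 1")
    case False
    then have "p \<le> r + 1"
      using Suc.prems by simp
    then show ?thesis
      using Suc.IH by (simp add: second_diff_def algebra_simps)
  qed (simp add: algebra_simps)
qed

lemma sum_diff_left:
  fixes F :: "int \<Rightarrow> real"
  assumes "1 \<le> p"
  shows "(\<Sum>i\<in>{1..<p}. F (Y - int i) - F (Y - int i + 1)) = F (Y - int p + 1) - F Y"
  using assms by (induction p rule: dec_induct) (auto simp: algebra_simps)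

lemma sum_diff_right:
  fixes F :: "int \<Rightarrow> real"
  shows "(\<Sum>j=1..m. F (Y + int j) - F (Y + int j + 1)) = F (Y + 1) - F (Y + int m + 1)"
  by (induction m) (auto simp: algebra_simps)

text \<open>
  The rows of \<open>mu\<close> above row \<open>p\<close> are summed row by row, those from row \<open>p\<close> on
  column by column.
\<close>

lemma sum_second_diff_diagram:
  assumes mu: "mu \<in> young_diagrams" and p: "1 \<le> p"
  shows "(\<Sum>y\<in>mu. second_diff F (X - cell_content y)) =
     F (X - int p + 1 + int (row_length mu p)) - F X +
     (\<Sum>i\<in>{1..<p}. F (X - int i + int (row_length mu i) + 1) - F (X - int i + int (row_length mu i))) +
     (\<Sum>j=1..row_length mu p. F (X - int (row_length (conjugate mu) j) + int j - 1)
        - F (X - int (row_length (conjugate mu) j) + int j))"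
proof -
  \<comment> \<open>The boundary terms correspond to what changes when a cell of row
    \<open>p\<close> is added to the other diagram: the new cell itself, the legs above it, and the
    arms attached to row \<open>p\<close> of \<open>mu\<close>. The pairs in \<open>B\<close> are
    (column, row).\<close>
  define A where "A = Sigma {1..<p} (\<lambda>i. {1..row_length mu i})"
  define B where "B = Sigma {1..row_length mu p} (\<lambda>j. {p..row_length (conjugate mu) j})"
  have mem_B: "(i, j) \<in> mu \<longleftrightarrow> (j, i) \<in> B" if "p \<le> i" for i j
  proof
    assume ij: "(i, j) \<in> mu"
    then have "(p, j) \<in> mu"
      using young_diagrams_down[OF mu ij, of p j] p that young_diagrams_pos[OF mu ij] by auto
    then show "(j, i) \<in> B"
      using ij that unfolding B_def
      by (auto simp: in_young_diagram_row[OF mu, of p] in_young_diagram_column[OF mu, of i])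
  next
    assume "(j, i) \<in> B"
    then show "(i, j) \<in> mu"
      using p that unfolding B_def by (auto simp: in_young_diagram_column[OF mu])
  qed
  have mem_A: "(i, j) \<in> mu \<longleftrightarrow> (i, j) \<in> A" if "i < p" for i j
    using that young_diagrams_pos(1)[OF mu, of i j] in_young_diagram_row[OF mu, of i j]
    unfolding A_def by auto
  have A_less: "i < p" if "(i, j) \<in> A" for i j
    using that by (auto simp: A_def)
  have B_ge: "p \<le> i" if "(j, i) \<in> B" for i j
    using that by (auto simp: B_def)
  have mu_eq: "mu = A \<union> prod.swap ` B"
  proof (rule set_eqI)
    fix x :: "nat \<times> nat"
    obtain i j where x: "x = (i, j)"
      by (cases x)
    have "x \<in> prod.swap ` B \<longleftrightarrow> (j, i) \<in> B"
      unfolding x by force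
    then show "x \<in> mu \<longleftrightarrow> x \<in> A \<union> prod.swap ` B"
      using mem_A[of i j] mem_B[of i j] A_less[of i j] B_ge[of j i] unfolding x
      by (cases "i < p") (auto simp: not_less)
  qed
  have disj: "A \<inter> prod.swap ` B = {}"
    using A_less B_ge by fastforce
  have split: "(\<Sum>y\<in>mu. second_diff F (X - cell_content y)) =
    (\<Sum>y\<in>A. second_diff F (X - cell_content y)) + (\<Sum>y\<in>prod.swap ` B. second_diff F (X - cell_content y))"
    unfolding mu_eq by (rule sum.union_disjoint) (use disj in \<open>auto simp: A_def B_def\<close>)
  have "(\<Sum>y\<in>A. second_diff F (X - cell_content y)) =
     (\<Sum>i\<in>{1..<p}. \<Sum>j=1..row_length mu i. second_diff F ((X - int i) + int j))"
    unfolding A_def by (subst sum.Sigma) (simp_all add: cell_content_def case_prod_unfold algebra_simps)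
  also have "\<dots> = (\<Sum>i\<in>{1..<p}. (F (X - int i + int (row_length mu i) + 1)
      - F (X - int i + int (row_length mu i))) + (F (X - int i) - F (X - int i + 1)))"
    by (intro sum.cong refl) (subst sum_second_diff_right, linarith)
  also have "\<dots> = (\<Sum>i\<in>{1..<p}. F (X - int i + int (row_length mu i) + 1)
      - F (X - int i + int (row_length mu i))) + (F (X - int p + 1) - F X)"
    by (simp only: sum.distrib[of "\<lambda>i. F (X - int i + int (row_length mu i) + 1)
      - F (X - int i + int (row_length mu i))"] sum_diff_left[OF p])
  finally have A_sum: "(\<Sum>y\<in>A. second_diff F (X - cell_content y)) = \<dots>" .
  have "(\<Sum>y\<in>prod.swap ` B. second_diff F (X - cell_content y)) =
     (\<Sum>j=1..row_length mu p. \<Sum>i=p..row_length (conjugate mu) j. second_diff F ((X + int j) - int i))"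
    unfolding B_def
    by (subst sum.reindex, simp, subst sum.Sigma) (auto simp: cell_content_def algebra_simps intro!: sum.cong)
  also have "\<dots> = (\<Sum>j=1..row_length mu p.
      F ((X + int j) - int p + 1) - F ((X + int j) - int p) -
      F ((X + int j) - int (row_length (conjugate mu) j)) +
      F ((X + int j) - int (row_length (conjugate mu) j) - 1))"
  proof (intro sum.cong refl sum_second_diff_left[OF p])
    fix j assume "j \<in> {1..row_length mu p}"
    then have "(p, j) \<in> mu"
      by (simp add: in_young_diagram_row[OF mu])
    then show "p \<le> row_length (conjugate mu) j + 1"
      by (simp add: in_young_diagram_column[OF mu])
  qed
  also have "\<dots> = (\<Sum>j=1..row_length mu p.
      (F (X - int (row_length (conjugate mu) j) + int j - 1)
        - F (X - int (row_length (conjugate mu) j) + int j)) -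
      (F ((X - int p) + int j) - F ((X - int p) + int j + 1)))"
    by (intro sum.cong refl) (simp add: algebra_simps)
  also have "\<dots> = (\<Sum>j=1..row_length mu p. F (X - int (row_length (conjugate mu) j) + int j - 1)
        - F (X - int (row_length (conjugate mu) j) + int j)) -
      (F (X - int p + 1) - F (X - int p + int (row_length mu p) + 1))"
    by (simp only: sum_subtractf[of "\<lambda>j. F (X - int (row_length (conjugate mu) j) + int j - 1)
        - F (X - int (row_length (conjugate mu) j) + int j)"] sum_diff_right)
  finally have B_sum: "(\<Sum>y\<in>prod.swap ` B. second_diff F (X - cell_content y)) = \<dots>" .
  show ?thesis
    unfolding split A_sum B_sum by (simp add: add.commute add.left_commute)
qed

text \<open>With an empty second diagram the arm is \<open>- j\<close>, and the value becomes the
  content of the cell reflected within its column. This is the base case of the content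
  identity.\<close>

lemma sum_column_reversal:
  fixes F :: "int \<Rightarrow> real"
  assumes mu: "mu \<in> young_diagrams"
  shows "(\<Sum>(i, j)\<in>mu. F (arm_leg mu {} i j)) = (\<Sum>y\<in>mu. F (cell_content y))"
proof -
  have empty: "row_length {} i = 0" for i
    by (simp add: row_length_def)
  define f where "f = (\<lambda>(i, j). (row_length (conjugate mu) j + 1 - i, j))"
  have f: "f y \<in> mu" "f (f y) = y" if "y \<in> mu" for y
    using that by (cases y; auto simp: f_def in_young_diagram_column[OF mu])+
  show ?thesis
  proof (rule sum.reindex_bij_witness[of _ f f])
    fix y assume "y \<in> mu"
    then show "F (cell_content (f y)) = (case y of (i, j) \<Rightarrow> F (arm_leg mu {} i j))"
      by (cases y) (auto simp: f_def in_young_diagram_column[OF mu] arm_leg_def cell_content_def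
          empty of_nat_diff intro!: arg_cong[of _ _ F])
  qed (use f in auto)
qed

lemma sum_change_on_subset:
  fixes f g :: "'a \<Rightarrow> real"
  assumes "finite A" "B \<subseteq> A" "\<And>x. x \<in> A - B \<Longrightarrow> f x = g x"
  shows "sum f A = sum g A + (\<Sum>x\<in>B. f x - g x)"
proof -
  have "(\<Sum>x\<in>A. f x - g x) = (\<Sum>x\<in>B. f x - g x)"
    using assms by (intro sum.mono_neutral_right) auto
  then show ?thesis
    by (simp add: sum_subtractf)
qed

text \<open>
  This is the character identity
  \<open>\<Sum> q^arm_leg = W* V_mu + V_lam* W - (1 - q) (1 - 1/q) V_lam* V_mu\<close> of the Nekrasov factors,
  tested against an arbitrary function \<open>F\<close>.
\<close>

lemma arm_leg_content_identity:
  assumes lam: "lam \<in> young_diagrams" and mu: "mu \<in> young_diagrams"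
  shows "(\<Sum>(i, j)\<in>lam. F (a + arm_leg lam mu i j)) + (\<Sum>(i, j)\<in>mu. F (a - arm_leg mu lam i j)) =
    (\<Sum>x\<in>lam. F (a + cell_content x)) + (\<Sum>y\<in>mu. F (a - cell_content y)) +
    (\<Sum>x\<in>lam. \<Sum>y\<in>mu. second_diff F (a + cell_content x - cell_content y))"
  using lam
proof (induction rule: young_diagrams_induct)
  case empty
  show ?case
    using sum_column_reversal[OF mu, of "\<lambda>m. F (a - m)"] by simp
next
  case (insert lam p q)
  define nu where "nu = insert (p, q) lam"
  define X where "X = a + int p - int q"
  have fin: "finite lam" "finite mu"
    using insert.hyps mu by (auto intro: young_diagrams_finite)
  have nu: "nu \<in> young_diagrams"
    using insert.hyps by (simp add: nu_def)
  have p: "1 \<le> p" and q: "1 \<le> q"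
    using young_diagrams_pos[OF nu, of p q] by (auto simp: nu_def)
  have rowp: "{j. (p, j) \<in> nu} = {1..q}" and colq: "{i. (i, q) \<in> nu} = {1..p}"
    using row_eq[OF nu, of p] row_eq[OF conjugate_young_diagrams[OF nu], of q] insert.hyps
    by (auto simp: nu_def conjugate_iff)
  have lam_eq: "lam = nu - {(p, q)}"
    using insert.hyps by (auto simp: nu_def)
  have rows: "row_length nu i = (if i = p then row_length lam p + 1 else row_length lam i)" for i
  proof -
    have "{j. (p, j) \<in> lam} = {1..q} - {q}"
      using rowp unfolding lam_eq by auto
    then have "row_length lam p = q - 1"
      using q by (simp add: row_length_def)
    moreover have "row_length nu p = q"
      using insert.hyps by (simp add: nu_def)
    ultimately show ?thesis
      using q by (auto simp: nu_def row_length_def)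
  qed
  have cols: "row_length (conjugate nu) j =
      (if j = q then row_length (conjugate lam) q + 1 else row_length (conjugate lam) j)" for j
  proof -
    have "{i. (i, q) \<in> lam} = {1..p} - {p}"
      using colq unfolding lam_eq by auto
    then have "row_length (conjugate lam) q = p - 1"
      using p by (simp add: row_length_conjugate)
    moreover have "row_length (conjugate nu) q = p"
      using insert.hyps by (simp add: nu_def)
    ultimately show ?thesis
      using p by (auto simp: nu_def row_length_conjugate)
  qed
  have rlp: "row_length nu p = q" and clq: "row_length (conjugate nu) q = p"
    using insert.hyps by (simp_all add: nu_def)
  have row_lam: "int (row_length lam p) = int q - 1"
    and col_lam: "int (row_length (conjugate lam) q) = int p - 1"
    using rlp clq rows[of p] cols[of q] by simp_all
  \<comment> \<open>Only the legs in column \<open>q\<close> grow, each by one, and the affected old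
    cells are those above the new one.\<close>
  have s1: "(\<Sum>(i, j)\<in>lam. F (a + arm_leg nu mu i j)) =
    (\<Sum>(i, j)\<in>lam. F (a + arm_leg lam mu i j)) +
    (\<Sum>i\<in>{1..<p}. F (X - int i + int (row_length mu i) + 1) - F (X - int i + int (row_length mu i)))"
  proof -
    have "(\<Sum>(i, j)\<in>lam. F (a + arm_leg nu mu i j)) =
      (\<Sum>(i, j)\<in>lam. F (a + arm_leg lam mu i j)) +
      (\<Sum>x\<in>(\<lambda>i. (i, q)) ` {1..<p}. (case x of (i, j) \<Rightarrow> F (a + arm_leg nu mu i j)) -
          (case x of (i, j) \<Rightarrow> F (a + arm_leg lam mu i j)))"
    proof (rule sum_change_on_subset[OF fin(1)])
      show "(\<lambda>i. (i, q)) ` {1..<p} \<subseteq> lam"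
        using colq unfolding lam_eq by auto
      fix x assume x: "x \<in> lam - (\<lambda>i. (i, q)) ` {1..<p}"
      have "(i, q) \<in> nu \<longleftrightarrow> i \<in> {1..p}" for i
        using colq by blast
      then have "(i, q) \<in> lam \<Longrightarrow> i \<in> {1..<p}" for i
        unfolding lam_eq by auto
      then have "snd x \<noteq> q"
        using x by (cases x) auto
      then show "(case x of (i, j) \<Rightarrow> F (a + arm_leg nu mu i j)) =
          (case x of (i, j) \<Rightarrow> F (a + arm_leg lam mu i j))"
        by (cases x) (simp add: arm_leg_def cols)
    qed
    also have "(\<Sum>x\<in>(\<lambda>i. (i, q)) ` {1..<p}. (case x of (i, j) \<Rightarrow> F (a + arm_leg nu mu i j)) -
          (case x of (i, j) \<Rightarrow> F (a + arm_leg lam mu i j))) =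
      (\<Sum>i\<in>{1..<p}. F (X - int i + int (row_length mu i) + 1) - F (X - int i + int (row_length mu i)))"
      by (simp add: sum.reindex inj_on_def arm_leg_def X_def col_lam clq algebra_simps)
    finally show ?thesis .
  qed
  \<comment> \<open>Here the growing diagram supplies the arms, so only row \<open>p\<close> of
    \<open>mu\<close> is affected; the argument of \<open>F\<close> drops by one because of the
    minus sign.\<close>
  have s2: "(\<Sum>(i, j)\<in>mu. F (a - arm_leg mu nu i j)) =
    (\<Sum>(i, j)\<in>mu. F (a - arm_leg mu lam i j)) +
    (\<Sum>j=1..row_length mu p. F (X - int (row_length (conjugate mu) j) + int j - 1)
        - F (X - int (row_length (conjugate mu) j) + int j))"
  proof -
    have "(\<Sum>(i, j)\<in>mu. F (a - arm_leg mu nu i j)) =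
      (\<Sum>(i, j)\<in>mu. F (a - arm_leg mu lam i j)) +
      (\<Sum>x\<in>(\<lambda>j. (p, j)) ` {1..row_length mu p}. (case x of (i, j) \<Rightarrow> F (a - arm_leg mu nu i j)) -
          (case x of (i, j) \<Rightarrow> F (a - arm_leg mu lam i j)))"
    proof (rule sum_change_on_subset[OF fin(2)])
      show "(\<lambda>j. (p, j)) ` {1..row_length mu p} \<subseteq> mu"
        by (auto simp: in_young_diagram_row[OF mu])
      fix x assume x: "x \<in> mu - (\<lambda>j. (p, j)) ` {1..row_length mu p}"
      then have "fst x \<noteq> p"
        by (cases x) (auto simp: in_young_diagram_row[OF mu] image_iff)
      then show "(case x of (i, j) \<Rightarrow> F (a - arm_leg mu nu i j)) =
          (case x of (i, j) \<Rightarrow> F (a - arm_leg mu lam i j))"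
        by (cases x) (simp add: arm_leg_def rows)
    qed
    also have "(\<Sum>x\<in>(\<lambda>j. (p, j)) ` {1..row_length mu p}. (case x of (i, j) \<Rightarrow> F (a - arm_leg mu nu i j)) -
          (case x of (i, j) \<Rightarrow> F (a - arm_leg mu lam i j))) =
      (\<Sum>j=1..row_length mu p. F (X - int (row_length (conjugate mu) j) + int j - 1)
        - F (X - int (row_length (conjugate mu) j) + int j))"
      by (simp add: sum.reindex inj_on_def arm_leg_def X_def row_lam rlp algebra_simps)
    finally show ?thesis .
  qed
  have new: "F (a + arm_leg nu mu p q) = F (X - int p + 1 + int (row_length mu p))"
    by (rule arg_cong[of _ _ F]) (simp add: arm_leg_def clq X_def)
  have "(\<Sum>(i, j)\<in>nu. F (a + arm_leg nu mu i j)) + (\<Sum>(i, j)\<in>mu. F (a - arm_leg mu nu i j)) =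
    F (a + arm_leg nu mu p q) + (\<Sum>(i, j)\<in>lam. F (a + arm_leg nu mu i j)) +
    (\<Sum>(i, j)\<in>mu. F (a - arm_leg mu nu i j))"
    using insert.hyps fin by (simp add: nu_def)
  also have "\<dots> = (\<Sum>(i, j)\<in>lam. F (a + arm_leg lam mu i j)) + (\<Sum>(i, j)\<in>mu. F (a - arm_leg mu lam i j))
     + F X + (\<Sum>y\<in>mu. second_diff F (X - cell_content y))"
    unfolding s1 s2 new sum_second_diff_diagram[OF mu p] by simp
  also have "\<dots> = (\<Sum>x\<in>nu. F (a + cell_content x)) + (\<Sum>y\<in>mu. F (a - cell_content y)) +
    (\<Sum>x\<in>nu. \<Sum>y\<in>mu. second_diff F (a + cell_content x - cell_content y))"
    unfolding insert.IH using insert.hyps fin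
    by (simp add: nu_def cell_content_def X_def algebra_simps)
  finally show ?case
    unfolding nu_def .
qed

section \<open>The logarithmic energy of a pair of diagrams\<close>

text \<open>The summand 1 keeps the logarithm finite at 0. It costs only a constant per factor, as
  the distance of a non-integer to the integers is positive.\<close>

definition log_kernel :: "int \<Rightarrow> real" where
  "log_kernel m = ln (1 + \<bar>of_int m\<bar>)"

lemma log_kernel_minus: "log_kernel (- m) = log_kernel m"
  by (simp add: log_kernel_def)

lemma log_kernel_mono: "\<bar>m\<bar> \<le> \<bar>m'\<bar> \<Longrightarrow> log_kernel m \<le> log_kernel m'"
  unfolding log_kernel_def by (subst ln_le_cancel_iff) linarith+

lemma exp_log_kernel: "exp (log_kernel m) = 1 + \<bar>of_int m\<bar>"
  by (simp add: log_kernel_def)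

lemma second_diff_minus:
  assumes "\<And>m. F (- m) = F m"
  shows "second_diff F (- m) = second_diff F m"
proof -
  have "F (- m - 1) = F (m + 1)" "F (- m + 1) = F (m - 1)"
    by (metis assms minus_add_distrib uminus_add_conv_diff add.commute diff_conv_add_uminus,
        metis assms minus_diff_eq uminus_add_conv_diff add.commute)
  then show ?thesis
    using assms[of m] by (simp add: second_diff_def)
qed

text \<open>Concavity of the logarithm, through r (r + 2) \<le> (r + 1)^2. The kink at 0 is the one
  place where the second difference is positive.\<close>

lemma second_diff_log_kernel_nonpos:
  assumes "m \<noteq> 0"
  shows "second_diff log_kernel m \<le> 0"
proof -
  have pos: "second_diff log_kernel m \<le> 0" if "m > 0" for m :: int
  proof -
    define r where "r = real_of_int m"
    have r: "r \<ge> 1"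
      using that unfolding r_def by linarith
    have "ln (r + 2) + ln r = ln ((r + 2) * r)"
      using r by (simp add: ln_mult)
    also have "\<dots> \<le> ln ((r + 1) * (r + 1))"
      using r by (subst ln_le_cancel_iff) (auto simp: algebra_simps add_pos_nonneg)
    also have "\<dots> = 2 * ln (r + 1)"
      using r by (simp add: ln_mult)
    finally show ?thesis
      using that r by (simp add: second_diff_def log_kernel_def r_def add.commute)
  qed
  show ?thesis
    using pos[of m] pos[of "- m"] second_diff_minus[of log_kernel m] log_kernel_minus assms
    by (cases "m > 0") auto
qed

lemma symmetric_interval_Suc:
  "{- int (Suc R)..int (Suc R)} = insert (- int (Suc R)) (insert (int (Suc R)) {- int R..int R})"
  by auto

lemma sum_symmetric_interval_Suc:
  fixes g :: "int \<Rightarrow> real"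
  shows "(\<Sum>x\<in>{- int (Suc R)..int (Suc R)}. g x) =
    g (- int (Suc R)) + g (int (Suc R)) + (\<Sum>x\<in>{- int R..int R}. g x)"
  unfolding symmetric_interval_Suc by simp

lemma sum_second_diff_interval:
  "(\<Sum>y\<in>{- int R..int R}. second_diff F (x - y)) =
     F (x + int R + 1) - F (x + int R) + F (x - int R - 1) - F (x - int R)"
proof (induction R)
  case 0
  then show ?case
    by (simp add: second_diff_def)
next
  case (Suc R)
  show ?case
    unfolding sum_symmetric_interval_Suc Suc.IH
    by (simp add: second_diff_def algebra_simps)
qed

text \<open>After telescoping only the steps just beyond the two ends of the interval survive. Both
  lead away from 0, the direction in which the kernel increases.\<close>

lemma log_kernel_column_sum_nonneg:
  assumes "\<bar>x\<bar> \<le> int R"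
  shows "0 \<le> (\<Sum>y\<in>{- int R..int R}. second_diff log_kernel (x - y))"
proof -
  have "log_kernel (x + int R) \<le> log_kernel (x + int R + 1)"
    "log_kernel (x - int R) \<le> log_kernel (x - int R - 1)"
    using assms by (auto intro!: log_kernel_mono)
  then show ?thesis
    by (simp add: sum_second_diff_interval)
qed

text \<open>
  The kernel is diagonally dominant: off the diagonal it is nonpositive, and its sums over the
  columns telescope to nonnegative values.
\<close>

lemma log_kernel_positive_semidefinite:
  fixes v :: "int \<Rightarrow> real" and R :: nat
  defines "X \<equiv> {- int R..int R}"
  shows "0 \<le> (\<Sum>x\<in>X. \<Sum>y\<in>X. v x * v y * second_diff log_kernel (x - y))"
proof -
  let ?D = "\<lambda>x y. second_diff log_kernel (x - y)"
  have sym: "?D x y = ?D y x" for x y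
    using second_diff_minus[of log_kernel "x - y"] log_kernel_minus by simp
  have row: "0 \<le> (\<Sum>x\<in>X. (v x)\<^sup>2 * (\<Sum>y\<in>X. ?D x y))"
    unfolding X_def
    by (intro sum_nonneg mult_nonneg_nonneg log_kernel_column_sum_nonneg) auto
  have off: "(v x - v y)\<^sup>2 * ?D x y \<le> 0" for x y
    using second_diff_log_kernel_nonpos[of "x - y"]
    by (cases "x = y") (auto intro: mult_nonneg_nonpos)
  \<comment> \<open>Twice the product of v x and v y is the sum of their squares minus the square of
    their difference. The difference vanishes on the diagonal and meets a nonpositive kernel off it,
    so the mixed sum is bounded below by the column sums.\<close>
  have "(\<Sum>x\<in>X. \<Sum>y\<in>X. (v x)\<^sup>2 * ?D x y + (v y)\<^sup>2 * ?D x y - 2 * (v x * v y * ?D x y)) =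
    (\<Sum>x\<in>X. \<Sum>y\<in>X. (v x - v y)\<^sup>2 * ?D x y)"
    by (intro sum.cong refl) (simp add: power2_eq_square algebra_simps)
  also have "\<dots> \<le> 0"
    by (intro sum_nonpos off)
  finally have "(\<Sum>x\<in>X. \<Sum>y\<in>X. (v x)\<^sup>2 * ?D x y) + (\<Sum>x\<in>X. \<Sum>y\<in>X. (v y)\<^sup>2 * ?D x y)
     \<le> 2 * (\<Sum>x\<in>X. \<Sum>y\<in>X. v x * v y * ?D x y)"
    by (simp add: sum.distrib sum_subtractf sum_distrib_left)
  moreover have "(\<Sum>x\<in>X. \<Sum>y\<in>X. (v y)\<^sup>2 * ?D x y) = (\<Sum>x\<in>X. \<Sum>y\<in>X. (v x)\<^sup>2 * ?D x y)"
    by (subst sum.swap) (simp add: sym)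
  moreover have "(\<Sum>x\<in>X. \<Sum>y\<in>X. (v x)\<^sup>2 * ?D x y) = (\<Sum>x\<in>X. (v x)\<^sup>2 * (\<Sum>y\<in>X. ?D x y))"
    by (simp add: sum_distrib_left)
  ultimately show ?thesis
    using row by linarith
qed

section \<open>The tent function and its energy\<close>

text \<open>For N > 0 its second difference is 1 at N and at - N, - 2 at 0, and 0 elsewhere; the
  convolution formula below is the dual statement.\<close>

definition tent :: "nat \<Rightarrow> int \<Rightarrow> real" where
  "tent N x = max 0 (of_int (int N - \<bar>x\<bar>))"

lemma tent_outside: "int N \<le> \<bar>x\<bar> \<Longrightarrow> tent N x = 0"
  unfolding tent_def max_def by (metis diff_le_0_iff_le of_int_le_0_iff antisym)

lemma tent_inside: "\<bar>x\<bar> \<le> int N \<Longrightarrow> tent N x = of_int (int N - \<bar>x\<bar>)"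
  unfolding tent_def by (intro max_absorb2) simp

text \<open>Raising N by one adds 1 at every point of \<open>{- int N..int N}\<close>, and the new
  end points carry weight 0; the increment is therefore the telescoped sum over the
  interval.\<close>

lemma tent_convolution_aux:
  "(\<Sum>y\<in>{- int N..int N}. tent N y * second_diff F (x - y)) = F (x + int N) + F (x - int N) - 2 * F x"
proof (induction N)
  case 0
  then show ?case
    by (simp add: tent_outside)
next
  case (Suc N)
  have "(\<Sum>y\<in>{- int (Suc N)..int (Suc N)}. tent (Suc N) y * second_diff F (x - y)) =
     (\<Sum>y\<in>{- int N..int N}. tent (Suc N) y * second_diff F (x - y))"
    unfolding sum_symmetric_interval_Suc by (simp add: tent_outside)
  also have "\<dots> = (\<Sum>y\<in>{- int N..int N}. tent N y * second_diff F (x - y) + second_diff F (x - y))"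
    by (intro sum.cong refl) (auto simp: tent_inside algebra_simps)
  finally show ?case
    using Suc.IH by (simp add: sum.distrib sum_second_diff_interval algebra_simps)
qed

lemma sum_tent:
  assumes "N \<le> R"
  shows "(\<Sum>y\<in>{- int R..int R}. tent N y * g y) = (\<Sum>y\<in>{- int N..int N}. tent N y * g y)"
  using assms by (intro sum.mono_neutral_right) (auto intro!: tent_outside)

lemma tent_convolution:
  assumes "N \<le> R"
  shows "(\<Sum>y\<in>{- int R..int R}. tent N y * second_diff F (x - y)) =
           F (x + int N) + F (x - int N) - 2 * F x"
  by (simp only: sum_tent[OF assms] tent_convolution_aux)

text \<open>The half of Stirling's formula that removes the N ln N from the sum of logarithms in the
  tent energy.\<close>

lemma ln_fact_ge: "real n * ln (real n) - real n \<le> ln (fact n)"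
proof (induction n)
  case 0
  then show ?case
    by simp
next
  case (Suc n)
  show ?case
  proof (cases "n = 0")
    case False
    have "ln (real (Suc n)) - ln (real n) = ln (1 + 1 / real n)"
      using False by (subst ln_divide_pos[symmetric]) (auto simp: field_simps)
    also have "\<dots> \<le> 1 / real n"
      using False by (intro ln_add_one_self_le_self) auto
    finally have "real n * (ln (real (Suc n)) - ln (real n)) \<le> real n * (1 / real n)"
      by (intro mult_left_mono) auto
    then have "real n * ln (real (Suc n)) \<le> real n * ln (real n) + 1"
      using False by (simp add: algebra_simps)
    moreover have "ln (fact (Suc n)) = ln (real (Suc n)) + ln (fact n :: real)"
      by (simp add: ln_mult)
    ultimately show ?thesis
      using Suc.IH by (simp add: algebra_simps)
  qed simp
qed

lemma sum_symmetric_interval_le: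
  fixes g :: "nat \<Rightarrow> real"
  assumes "\<And>k. k \<le> R \<Longrightarrow> 0 \<le> g k"
  shows "(\<Sum>x\<in>{- int R..int R}. g (nat \<bar>x\<bar>)) \<le> 2 * (\<Sum>k\<le>R. g k)"
  using assms
proof (induction R)
  case (Suc R)
  then show ?case
    unfolding sum_symmetric_interval_Suc by (simp add: nat_add_distrib)
qed simp

text \<open>Strictly inside the tent, 1 + |x + N| and 1 + |x - N| are at most 2N, so the bracket is
  at most twice ln (2N / (1 + |x|)). By Stirling these logarithms sum to O(N), and the height of the
  tent contributes the other N. Bounding each logarithm by ln (2N) would only give N^2 ln N.\<close>

lemma tent_energy_le:
  "(\<Sum>x\<in>{- int N..int N}. tent N x *
      (log_kernel (x + int N) + log_kernel (x - int N) - 2 * log_kernel x)) \<le> 8 * (real N)\<^sup>2"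
proof (cases "N = 0")
  case False
  define g where "g k = (if k < N then ln (2 * real N) - ln (1 + real k) else 0)" for k
  have g_nonneg: "0 \<le> g k" for k
    unfolding g_def by auto
  have pointwise: "tent N x * (log_kernel (x + int N) + log_kernel (x - int N) - 2 * log_kernel x) \<le>
      2 * real N * g (nat \<bar>x\<bar>)" if "x \<in> {- int N..int N}" for x
  proof (cases "\<bar>x\<bar> = int N")
    case True
    then show ?thesis
      by (simp add: tent_outside g_def)
  next
    case inside: False
    then have x: "\<bar>x\<bar> < int N"
      using that by auto
    have "log_kernel (x + int N) \<le> ln (2 * real N)" "log_kernel (x - int N) \<le> ln (2 * real N)"
      using x unfolding log_kernel_def by (subst ln_le_cancel_iff; linarith)+
    moreover have "log_kernel x = ln (1 + real (nat \<bar>x\<bar>))"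
      by (simp add: log_kernel_def)
    ultimately have "log_kernel (x + int N) + log_kernel (x - int N) - 2 * log_kernel x \<le> 2 * g (nat \<bar>x\<bar>)"
      using x by (simp add: g_def nat_less_iff)
    then have "tent N x * (log_kernel (x + int N) + log_kernel (x - int N) - 2 * log_kernel x) \<le>
        tent N x * (2 * g (nat \<bar>x\<bar>))"
      by (rule mult_left_mono) (simp add: tent_def)
    also have "\<dots> \<le> real N * (2 * g (nat \<bar>x\<bar>))"
      using g_nonneg by (intro mult_right_mono) (auto simp: tent_def)
    finally show ?thesis
      by (simp add: mult_ac)
  qed
  have ln2: "ln (2::real) \<le> 1"
    using ln_le_minus_one[of 2] by simp
  have "(\<Sum>k\<le>N. g k) = (\<Sum>k<N. ln (2 * real N) - ln (1 + real k))"
    unfolding lessThan_Suc_atMost[symmetric] by (simp add: g_def)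
  also have "\<dots> = real N * ln (2 * real N) - ln (fact N)"
    by (simp add: sum_subtractf fact_prod_Suc ln_prod atLeast0LessThan)
  also have "\<dots> = real N * ln 2 + (real N * ln (real N) - ln (fact N))"
    using False by (simp add: ln_mult algebra_simps)
  also have "\<dots> \<le> real N * 1 + real N"
    using ln_fact_ge[of N] ln2 by (intro add_mono mult_left_mono) auto
  finally have g_sum: "(\<Sum>k\<le>N. g k) \<le> 2 * real N"
    by simp
  have "(\<Sum>x\<in>{- int N..int N}. tent N x *
      (log_kernel (x + int N) + log_kernel (x - int N) - 2 * log_kernel x)) \<le>
      (\<Sum>x\<in>{- int N..int N}. 2 * real N * g (nat \<bar>x\<bar>))"
    by (rule sum_mono) (rule pointwise)
  also have "\<dots> \<le> 2 * real N * (2 * (\<Sum>k\<le>N. g k))"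
    unfolding sum_distrib_left[symmetric]
    by (intro mult_left_mono sum_symmetric_interval_le g_nonneg) auto
  also have "\<dots> \<le> 2 * real N * (2 * (2 * real N))"
    using g_sum by (intro mult_left_mono) auto
  finally show ?thesis
    by (simp add: power2_eq_square)
qed (simp add: tent_outside)

lemma sum_counting_function:
  fixes g :: "int \<Rightarrow> real"
  assumes "finite A" "finite X" "pos ` A \<subseteq> X"
  shows "(\<Sum>x\<in>X. (\<Sum>c\<in>A. if pos c = x then 1 else 0) * g x) = (\<Sum>c\<in>A. g (pos c))"
proof -
  have "(\<Sum>x\<in>X. (\<Sum>c\<in>A. if pos c = x then 1 else 0) * g x) =
        (\<Sum>c\<in>A. \<Sum>x\<in>X. if pos c = x then g x else 0)"
    by (subst sum.swap) (auto simp: sum_distrib_right if_distrib intro!: sum.cong)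
  also have "\<dots> = (\<Sum>c\<in>A. g (pos c))"
    using assms by (intro sum.cong refl) auto
  finally show ?thesis .
qed

text \<open>
  Positive semidefiniteness is applied to the contents of \<open>lam\<close> shifted by \<open>n\<close>, those of \<open>mu\<close>
  shifted by \<open>- n\<close>, and a tent of height \<open>\<bar>n\<bar>\<close>, whose convolution with the kernel turns the
  linear terms into the shifted contents on the left-hand side.
\<close>

lemma arm_leg_log_energy:
  assumes lam: "lam \<in> young_diagrams" and mu: "mu \<in> young_diagrams"
  shows "2 * (\<Sum>c\<in>lam. log_kernel (n + cell_content c)) + 2 * (\<Sum>c\<in>mu. log_kernel (cell_content c - n)) \<le>
    (\<Sum>(i, j)\<in>lam. log_kernel (hook_length lam i j) + log_kernel (2 * n + arm_leg lam mu i j)) +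
    (\<Sum>(i, j)\<in>mu. log_kernel (hook_length mu i j) + log_kernel (arm_leg mu lam i j - 2 * n)) +
    4 * (real_of_int n)\<^sup>2"
proof -
  let ?K = log_kernel and ?D = "second_diff log_kernel"
  have fin: "finite lam" "finite mu"
    using lam mu by (auto intro: young_diagrams_finite)
  define N where "N = nat \<bar>n\<bar>"
  define p where "p c = n + cell_content c" for c
  define q where "q c = cell_content c - n" for c
  obtain R0 :: nat where R0: "\<And>x. x \<in> p ` lam \<union> q ` mu \<Longrightarrow> \<bar>x\<bar> \<le> int R0"
  proof
    fix x assume "x \<in> p ` lam \<union> q ` mu"
    then have "nat \<bar>x\<bar> \<le> (\<Sum>y\<in>p ` lam \<union> q ` mu. nat \<bar>y\<bar>)"
      using fin by (intro member_le_sum) auto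
    then show "\<bar>x\<bar> \<le> int (\<Sum>y\<in>p ` lam \<union> q ` mu. nat \<bar>y\<bar>)"
      by linarith
  qed
  \<comment> \<open>Large enough to contain the tent and all shifted contents, so that restricting
    the kernel to \<open>X\<close> truncates none of them.\<close>
  define R where "R = max R0 N"
  define X where "X = {- int R..int R}"
  have NR: "N \<le> R"
    by (simp add: R_def)
  have sub: "p ` lam \<subseteq> X" "q ` mu \<subseteq> X"
    using R0 unfolding X_def R_def by (force simp: abs_le_iff)+
  define va where "va x = (\<Sum>c\<in>lam. if p c = x then 1 else 0 :: real)" for x
  define vb where "vb x = (\<Sum>c\<in>mu. if q c = x then 1 else 0 :: real)" for x
  define B where "B f g = (\<Sum>x\<in>X. f x * (\<Sum>y\<in>X. g y * ?D (x - y)))" for f g :: "int \<Rightarrow> real"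
  have sym: "?D (x - y) = ?D (y - x)" for x y
    using second_diff_minus[of ?K "x - y"] log_kernel_minus by simp
  have B_sym: "B f g = B g f" for f g
    unfolding B_def sum_distrib_left
    by (subst sum.swap) (intro sum.cong refl, subst sym, simp add: mult_ac)
  have suma: "(\<Sum>x\<in>X. va x * g x) = (\<Sum>c\<in>lam. g (p c))"
    and sumb: "(\<Sum>x\<in>X. vb x * g x) = (\<Sum>c\<in>mu. g (q c))" for g
    unfolding va_def vb_def by (rule sum_counting_function; use fin sub X_def in simp)+
  have "0 \<le> B (\<lambda>x. va x + vb x + tent N x) (\<lambda>x. va x + vb x + tent N x)"
    unfolding B_def sum_distrib_left X_def
    using log_kernel_positive_semidefinite[where R = R and v = "\<lambda>x. va x + vb x + tent N x"] by (simp add: mult.assoc)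
  also have "\<dots> = B va va + B vb vb + 2 * B va vb + 2 * B va (tent N) + 2 * B vb (tent N) + B (tent N) (tent N)"
    using B_sym[of vb va] B_sym[of "tent N" va] B_sym[of "tent N" vb]
    unfolding B_def by (simp add: algebra_simps sum.distrib)
  finally have psd: "0 \<le> \<dots>" .
  \<comment> \<open>The shifts cancel within one diagram, which leads to its hook lengths, and add
    up to \<open>2 * n\<close> between the diagrams, which leads to the mixed denominators.\<close>
  have Baa: "B va va = (\<Sum>x\<in>lam. \<Sum>y\<in>lam. ?D (0 + cell_content x - cell_content y))"
    and Bbb: "B vb vb = (\<Sum>x\<in>mu. \<Sum>y\<in>mu. ?D (0 + cell_content x - cell_content y))"
    and Bab: "B va vb = (\<Sum>x\<in>lam. \<Sum>y\<in>mu. ?D (2 * n + cell_content x - cell_content y))"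
    unfolding B_def suma sumb by (simp_all add: p_def q_def algebra_simps)
  have conv: "(\<Sum>y\<in>X. tent N y * ?D (x - y)) = ?K (x + n) + ?K (x - n) - 2 * ?K x" for x
    unfolding X_def tent_convolution[OF NR] by (auto simp: N_def abs_if)
  \<comment> \<open>From the position \<open>n + cell_content c\<close>, moving by n either way
    reaches \<open>2 * n + cell_content c\<close> and \<open>cell_content c\<close>: the linear
    terms of the mixed identity and of the hook identity.\<close>
  have Bat: "B va (tent N) = (\<Sum>c\<in>lam. ?K (2 * n + cell_content c)) + (\<Sum>c\<in>lam. ?K (0 + cell_content c))
      - 2 * (\<Sum>c\<in>lam. ?K (n + cell_content c))"
    unfolding B_def suma conv
    by (simp add: p_def sum.distrib sum_subtractf sum_distrib_left algebra_simps)
  have Kminus: "?K (cell_content c - 2 * n) = ?K (2 * n - cell_content c)"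
    "?K (0 - cell_content c) = ?K (cell_content c)" for c
    using log_kernel_minus[of "2 * n - cell_content c"] log_kernel_minus[of "cell_content c"] by simp_all
  have Bbt: "B vb (tent N) = (\<Sum>c\<in>mu. ?K (0 + cell_content c)) + (\<Sum>c\<in>mu. ?K (2 * n - cell_content c))
      - 2 * (\<Sum>c\<in>mu. ?K (cell_content c - n))"
    unfolding B_def sumb conv Kminus(1)[symmetric]
    by (simp add: q_def sum.distrib sum_subtractf sum_distrib_left algebra_simps)
  have "B (tent N) (tent N) = (\<Sum>x\<in>{- int N..int N}. tent N x * (?K (x + int N) + ?K (x - int N) - 2 * ?K x))"
    unfolding B_def X_def tent_convolution[OF NR] sum_tent[OF NR] ..
  also have "\<dots> \<le> 8 * (real N)\<^sup>2"
    by (rule tent_energy_le)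
  finally have Btt: "B (tent N) (tent N) \<le> 8 * (real_of_int n)\<^sup>2"
    by (simp add: N_def)
  have self: "2 * (\<Sum>(i, j)\<in>nu. ?K (hook_length nu i j)) = 2 * (\<Sum>c\<in>nu. ?K (0 + cell_content c)) +
      (\<Sum>x\<in>nu. \<Sum>y\<in>nu. ?D (0 + cell_content x - cell_content y))" if "nu \<in> young_diagrams" for nu
    using arm_leg_content_identity[OF that that, of ?K 0]
    by (simp add: arm_leg_self log_kernel_minus)
  have cross: "(\<Sum>(i, j)\<in>lam. ?K (2 * n + arm_leg lam mu i j)) + (\<Sum>(i, j)\<in>mu. ?K (arm_leg mu lam i j - 2 * n)) =
    (\<Sum>c\<in>lam. ?K (2 * n + cell_content c)) + (\<Sum>c\<in>mu. ?K (2 * n - cell_content c)) +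
    (\<Sum>x\<in>lam. \<Sum>y\<in>mu. ?D (2 * n + cell_content x - cell_content y))"
  proof -
    have "?K (arm_leg mu lam i j - 2 * n) = ?K (2 * n - arm_leg mu lam i j)" for i j
      using log_kernel_minus[of "2 * n - arm_leg mu lam i j"] by simp
    then show ?thesis
      using arm_leg_content_identity[OF lam mu, of ?K "2 * n"] by simp
  qed
  have "(\<Sum>(i, j)\<in>lam. ?K (hook_length lam i j) + ?K (2 * n + arm_leg lam mu i j)) =
      (\<Sum>(i, j)\<in>lam. ?K (hook_length lam i j)) + (\<Sum>(i, j)\<in>lam. ?K (2 * n + arm_leg lam mu i j))"
    and "(\<Sum>(i, j)\<in>mu. ?K (hook_length mu i j) + ?K (arm_leg mu lam i j - 2 * n)) =
      (\<Sum>(i, j)\<in>mu. ?K (hook_length mu i j)) + (\<Sum>(i, j)\<in>mu. ?K (arm_leg mu lam i j - 2 * n))"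
    by (simp_all add: case_prod_unfold sum.distrib)
  \<comment> \<open>Half of the positivity statement. Each hook sum is its linear part plus half of
    its quadratic part, and the tent energy 8 n^2 becomes 4 n^2.\<close>
  moreover have "2 * sl + 2 * sm \<le> hl' + hm' + 4 * m"
    if "hl' = hl + el" "hm' = hm + em" "0 \<le> ll + mm + 2 * lm + 2 * (zl + cl - 2 * sl) + 2 * (cm + zm - 2 * sm) + t"
      "t \<le> 8 * m" "2 * hl = 2 * cl + ll" "2 * hm = 2 * cm + mm" "el + em = zl + zm + lm"
    for sl sm hl hm hl' hm' el em ll mm lm zl zm cl cm t m :: real
    using that by argo
  ultimately show ?thesis
    using psd[unfolded Baa Bbb Bab Bat Bbt] Btt self[OF lam] self[OF mu] cross by blast
qed

section \<open>Growth of the Barnes function along shifts\<close>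

lemma norm_power_minus_one_le:
  fixes x :: complex
  assumes "real k * norm (x - 1) \<le> 1"
  shows "norm (x ^ k - 1) \<le> 2 * real k * norm (x - 1)"
proof -
  define d where "d = norm (x - 1)"
  have "norm (x ^ k - 1) \<le> (1 + d) ^ k - 1"
    using norm_prod_minus1_le_prod_minus1[of "\<lambda>_. x - 1" "{..<k}"] by (simp add: d_def)
  also have "(1 + d) ^ k \<le> exp d ^ k"
    by (intro power_mono exp_ge_add_one_self) (simp add: d_def)
  also have "exp d ^ k = exp (real k * d)"
    by (simp add: exp_of_nat_mult)
  also have "exp (real k * d) \<le> 1 + real k * d + (real k * d)\<^sup>2"
    using assms by (intro exp_bound) (auto simp: d_def)
  also have "(real k * d)\<^sup>2 \<le> real k * d"
    using assms by (simp add: power2_eq_square d_def mult_left_le)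
  finally show ?thesis
    by (simp add: d_def)
qed

text \<open>Multiplied by exp (- z), the sequence is the n-th power of the genus 1 Weierstrass
  factor at - z / n, which is 1 + O(1 / n^2).\<close>

lemma tendsto_exp_limit_complex:
  fixes z :: complex
  shows "(\<lambda>n. (1 + z / of_nat n) ^ n) \<longlonglongrightarrow> exp z"
proof -
  let ?E = "\<lambda>n. weierstrass_factor 1 (- z / of_nat n)"
  have lim: "(\<lambda>n. 6 * (norm z)\<^sup>2 / real n) \<longlonglongrightarrow> 0"
    by (rule lim_const_over_n)
  have "\<forall>\<^sub>F n in sequentially. norm (?E n ^ n - 1) \<le> 6 * (norm z)\<^sup>2 / real n"
    using eventually_ge_at_top[of "nat \<lceil>2 * norm z\<rceil> + nat \<lceil>3 * (norm z)\<^sup>2\<rceil> + 1"]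
  proof eventually_elim
    case (elim n)
    then have n: "n > 0" "2 * norm z \<le> real n" "3 * (norm z)\<^sup>2 \<le> real n"
      by linarith+
    have "norm (?E n - 1) \<le> 3 * norm (- z / of_nat n) ^ Suc 1"
      using n by (intro weierstrass_factor_bound) (simp add: norm_divide field_simps)
    then have *: "real n * norm (?E n - 1) \<le> 3 * (norm z)\<^sup>2 / real n"
      using n by (simp add: norm_divide power2_eq_square field_simps)
    also have "\<dots> \<le> 1"
      using n by simp
    finally show ?case
      using norm_power_minus_one_le[of n "?E n"] * by simp
  qed
  then have "(\<lambda>n. ?E n ^ n - 1) \<longlonglongrightarrow> 0"
    by (rule Lim_null_comparison[OF _ lim])
  then have "(\<lambda>n. ?E n ^ n * exp z) \<longlonglongrightarrow> 1 * exp z"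
    by (intro tendsto_mult tendsto_const) (simp add: LIM_zero_iff)
  moreover have "\<forall>\<^sub>F n in sequentially. ?E n ^ n * exp z = (1 + z / of_nat n) ^ n"
    using eventually_gt_at_top[of 0]
  proof eventually_elim
    case (elim n)
    then show ?case
      by (simp add: weierstrass_factor_def power_mult_distrib exp_of_nat_mult[symmetric] exp_add[symmetric] mult.assoc)
  qed
  ultimately show ?thesis
    by (auto dest: Lim_transform_eventually)
qed

definition Barnes_factor :: "complex \<Rightarrow> nat \<Rightarrow> complex" where
  "Barnes_factor w k = (1 + w / of_nat (Suc k)) ^ Suc k * exp (w\<^sup>2 / (2 * of_nat (Suc k)) - w)"

text \<open>With K = k + 1 this exhibits the factor as 1 + O(1 / K^2): a genus 2 factor differs from
  1 by O(1 / K^3), and the power K costs one order.\<close>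

lemma Barnes_factor_weierstrass:
  "Barnes_factor w k = weierstrass_factor 2 (- w / of_nat (Suc k)) ^ Suc k"
proof -
  define K where "K = (of_nat (Suc k) :: complex)"
  have K: "K \<noteq> 0"
    by (simp add: K_def del: of_nat_Suc)
  have "(\<Sum>i=1..2. (- w / K) ^ i / of_nat i) = - w / K + w\<^sup>2 / (2 * K\<^sup>2)"
    by (simp add: numeral_2_eq_2 power2_eq_square)
  then have "weierstrass_factor 2 (- w / K) ^ Suc k =
      (1 + w / K) ^ Suc k * exp (K * (- w / K + w\<^sup>2 / (2 * K\<^sup>2)))"
    unfolding weierstrass_factor_def K_def
    by (simp add: power_mult_distrib exp_of_nat_mult[symmetric] del: power_Suc of_nat_Suc)
  also have "K * (- w / K + w\<^sup>2 / (2 * K\<^sup>2)) = w\<^sup>2 / (2 * K) - w"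
    using K by (simp add: field_simps power2_eq_square)
  finally show ?thesis
    unfolding Barnes_factor_def K_def ..
qed

lemma Barnes_factor_convergent: "convergent_prod (Barnes_factor w)"
proof -
  have "summable (\<lambda>k. norm (Barnes_factor w k - 1))"
  proof (rule summable_comparison_test_ev)
    show "summable (\<lambda>k. 6 * norm w ^ 3 * inverse (real (Suc k) ^ 2))"
      by (intro summable_mult) (subst summable_Suc_iff, rule inverse_power_summable, simp)
    show "\<forall>\<^sub>F k in sequentially. norm (norm (Barnes_factor w k - 1)) \<le>
        6 * norm w ^ 3 * inverse (real (Suc k) ^ 2)"
      using eventually_ge_at_top[of "nat \<lceil>2 * norm w\<rceil> + nat \<lceil>3 * norm w ^ 3\<rceil> + 1"]
    proof eventually_elim
      case (elim k)
      define K where "K = real (Suc k)"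
      have K: "K \<ge> 1" "2 * norm w \<le> K" "3 * norm w ^ 3 \<le> K"
        using elim unfolding K_def by linarith+
      let ?E = "weierstrass_factor 2 (- w / of_nat (Suc k))"
      have nw: "norm (- w / of_nat (Suc k)) = norm w / K"
        unfolding K_def by (simp add: norm_divide del: of_nat_Suc)
      have "norm (?E - 1) \<le> 3 * (norm w / K) ^ Suc 2"
        unfolding nw[symmetric]
        by (rule weierstrass_factor_bound, unfold nw) (use K in \<open>simp add: field_simps\<close>)
      then have "K * norm (?E - 1) \<le> K * (3 * (norm w / K) ^ Suc 2)"
        using K by (intro mult_left_mono) auto
      also have "\<dots> = 3 * norm w ^ 3 * inverse (K ^ 2)"
        using K by (simp add: power_divide field_simps power2_eq_square power3_eq_cube)
      finally have *: "K * norm (?E - 1) \<le> 3 * norm w ^ 3 * inverse (K ^ 2)" .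
      also have "\<dots> \<le> K * inverse (K ^ 2)"
        using K by (intro mult_right_mono) auto
      also have "\<dots> \<le> 1"
        using K by (simp add: field_simps power2_eq_square)
      finally have "norm (Barnes_factor w k - 1) \<le> 2 * K * norm (?E - 1)"
        unfolding Barnes_factor_weierstrass K_def by (rule norm_power_minus_one_le)
      also have "\<dots> \<le> 6 * norm w ^ 3 * inverse (K ^ 2)"
        using * by (simp add: mult_ac)
      finally show ?case
        unfolding K_def by simp
    qed
  qed
  then show ?thesis
    by (intro abs_convergent_prod_imp_convergent_prod summable_imp_abs_convergent_prod)
qed

text \<open>The functional equation at finite level. The powers \<open>(M + w) ^ M\<close> telescope
  to a Pochhammer symbol and one boundary power, and the differences of the quadratic exponents add
  up to the harmonic number.\<close>

lemma Barnes_factor_partial_product: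
  "(\<Prod>k<N. Barnes_factor w k) * (of_nat N + 1 + w) ^ N * exp ((w + 1 / 2) * harm N - of_nat N) =
   (\<Prod>k<N. Barnes_factor (w + 1) k) * pochhammer (1 + w) N"
proof (induction N)
  case 0
  then show ?case
    by (simp add: harm_def)
next
  case (Suc N)
  define M where "M = (of_nat (Suc N) :: complex)"
  have M: "M \<noteq> 0"
    by (simp add: M_def del: of_nat_Suc)
  have h: "harm (Suc N) = harm N + 1 / M"
    by (simp add: harm_Suc M_def field_simps)
  have p: "1 + w / M = (M + w) / M" "1 + (w + 1) / M = (M + 1 + w) / M"
    using M by (simp_all add: field_simps)
  have e: "exp (w\<^sup>2 / (2 * M) - w) * exp ((w + 1 / 2) / M - 1) = exp ((w + 1)\<^sup>2 / (2 * M) - (w + 1))"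
    unfolding exp_add[symmetric]
    by (rule arg_cong[of _ _ exp]) (use M in \<open>simp add: field_simps power2_eq_square\<close>)
  have step: "Barnes_factor w N * (M + 1 + w) ^ Suc N * exp ((w + 1 / 2) / M - 1) =
      (M + w) ^ Suc N * Barnes_factor (w + 1) N"
    unfolding Barnes_factor_def M_def[symmetric] p power_divide
    using e by (simp add: mult_ac del: power_Suc)
  have "(\<Prod>k<Suc N. Barnes_factor w k) * (of_nat (Suc N) + 1 + w) ^ Suc N *
      exp ((w + 1 / 2) * harm (Suc N) - of_nat (Suc N)) =
      (\<Prod>k<N. Barnes_factor w k) * exp ((w + 1 / 2) * harm N - of_nat N) *
      (Barnes_factor w N * (M + 1 + w) ^ Suc N * exp ((w + 1 / 2) / M - 1))"
  proof -
    have "(w + 1 / 2) * harm (Suc N) - of_nat (Suc N) =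
        ((w + 1 / 2) * harm N - of_nat N) + ((w + 1 / 2) / M - 1)"
      unfolding h of_nat_Suc by (simp add: algebra_simps add_divide_distrib)
    then have "exp ((w + 1 / 2) * harm (Suc N) - of_nat (Suc N)) =
        exp ((w + 1 / 2) * harm N - of_nat N) * exp ((w + 1 / 2) / M - 1)"
      by (simp only: exp_add)
    then show ?thesis
      unfolding M_def by (simp only: prod.lessThan_Suc mult_ac)
  qed
  also have "\<dots> = ((\<Prod>k<N. Barnes_factor w k) * (of_nat N + 1 + w) ^ N *
      exp ((w + 1 / 2) * harm N - of_nat N)) * (M + w) * Barnes_factor (w + 1) N"
    unfolding step by (simp add: M_def mult_ac add_ac)
  also have "\<dots> = (\<Prod>k<Suc N. Barnes_factor (w + 1) k) * pochhammer (1 + w) (Suc N)"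
    unfolding Suc.IH by (simp add: M_def pochhammer_Suc mult_ac add_ac)
  finally show ?case .
qed

lemma Barnes_factor_partial_product_tendsto:
  "(\<lambda>N. \<Prod>k<N. Barnes_factor w k) \<longlonglongrightarrow> prodinf (Barnes_factor w)"
  using Barnes_factor_convergent convergent_prod_has_prod has_prod_imp_tendsto' by blast

text \<open>
  The limit of the Stirling sequence \<open>st\<close> is not computed; it exists and is nonzero because
  the products at \<open>w = 0\<close> and \<open>w = 1\<close> converge.
\<close>

lemma Barnes_product_shift:
  obtains l where "l \<noteq> 0"
    "\<And>z. prodinf (Barnes_factor (z - 1)) * (exp z * exp ((z - 1 / 2) * euler_mascheroni) * l) =
         prodinf (Barnes_factor z) * rGamma z"
proof -
  \<comment> \<open>The leftover of the partial products is split into \<open>st\<close>,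
    independent of \<open>z\<close>, and \<open>q\<close>. The logarithms of N are distributed so
    that \<open>q\<close> contains \<open>harm N - ln N\<close>; the remaining power of N belongs to
    the series for \<open>rGamma\<close>.\<close>
  define st :: "nat \<Rightarrow> complex" where
    "st N = of_nat N ^ Suc N * exp (- of_nat N - of_real (ln (real N)) / 2) / fact N" for N
  define q where "q z N = (1 + z / of_nat N) ^ N * (1 + z / of_nat N) *
      exp ((z - 1 / 2) * (harm N - of_real (ln (real N))))" for z :: complex and N
  have q_lim: "q z \<longlonglongrightarrow> exp z * exp ((z - 1 / 2) * euler_mascheroni)" for z
  proof -
    have "q z \<longlonglongrightarrow> exp z * (1 + 0) * exp ((z - 1 / 2) * euler_mascheroni)"
      unfolding q_def
    proof (intro tendsto_mult tendsto_exp tendsto_add tendsto_const tendsto_exp_limit_complex)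
      show "(\<lambda>N. z / of_nat N) \<longlonglongrightarrow> 0"
        by (rule lim_const_over_n)
      show "(\<lambda>N. harm N - of_real (ln (real N))) \<longlonglongrightarrow> (euler_mascheroni :: complex)"
        using euler_mascheroni_LIMSEQ_of_real[where 'a = complex] by (simp add: of_real_harm)
    qed
    then show ?thesis
      by simp
  qed
  have partial: "(\<Prod>k<N. Barnes_factor (z - 1) k) * (q z N * st N) =
      (\<Prod>k<N. Barnes_factor z k) * rGamma_series z N" if "N > 0" for z N
  proof -
    define n where "n = (of_nat N :: complex)"
    define l where "l = (of_real (ln (real N)) :: complex)"
    have n: "n \<noteq> 0"
      using that by (simp add: n_def)
    have base: "(\<Prod>k<N. Barnes_factor (z - 1) k) * (n + z) ^ N * exp ((z - 1 / 2) * harm N - n) * (z + n) =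
        (\<Prod>k<N. Barnes_factor z k) * pochhammer z (Suc N)"
      using Barnes_factor_partial_product[of "z - 1" N]
      by (simp add: pochhammer_Suc n_def algebra_simps)
    have "n + z = n * (1 + z / n)"
      using n by (simp add: field_simps)
    then have pow: "(1 + z / n) ^ N * (1 + z / n) * n ^ Suc N = (n + z) ^ N * (z + n)"
      by (simp add: power_mult_distrib add.commute[of z] mult_ac)
    have ex: "exp ((z - 1 / 2) * (harm N - l)) * exp (- n - l / 2) * exp (z * l) =
        exp ((z - 1 / 2) * harm N - n)"
      unfolding exp_add[symmetric] by (rule arg_cong[of _ _ exp]) (simp add: field_simps)
    have poch: "pochhammer z (Suc N) = rGamma_series z N * (fact N * exp (z * l))"
      by (simp add: rGamma_series_def l_def)
    have "(\<Prod>k<N. Barnes_factor (z - 1) k) * (q z N * st N) * (fact N * exp (z * l)) =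
        (\<Prod>k<N. Barnes_factor (z - 1) k) * ((1 + z / n) ^ N * (1 + z / n) * n ^ Suc N) *
        (exp ((z - 1 / 2) * (harm N - l)) * exp (- n - l / 2) * exp (z * l))"
      unfolding q_def st_def n_def[symmetric] l_def[symmetric] by (simp add: mult_ac)
    also have "\<dots> = (\<Prod>k<N. Barnes_factor z k) * rGamma_series z N * (fact N * exp (z * l))"
      unfolding pow ex using base unfolding poch by (simp only: mult_ac)
    finally have "(\<Prod>k<N. Barnes_factor (z - 1) k) * (q z N * st N) * (fact N * exp (z * l)) =
        (\<Prod>k<N. Barnes_factor z k) * rGamma_series z N * (fact N * exp (z * l))" .
    then show ?thesis
      by simp
  qed
  \<comment> \<open>Forced by the identity at z = 1, where the product on the left is identically 1
    and \<open>rGamma 1 = 1\<close>.\<close>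
  define l where "l = prodinf (Barnes_factor 1) / (exp 1 * exp ((1 - 1 / 2) * euler_mascheroni))"
  have "Barnes_factor 1 k \<noteq> 0" for k
  proof -
    have "(1 + 1 / of_nat (Suc k) :: complex) = of_nat (Suc (Suc k)) / of_nat (Suc k)"
      by (simp add: field_simps del: of_nat_Suc) simp
    then show ?thesis
      unfolding Barnes_factor_def by (simp del: of_nat_Suc)
  qed
  then have "l \<noteq> 0"
    unfolding l_def by (simp add: prodinf_nonzero[OF Barnes_factor_convergent])
  have B0: "Barnes_factor 0 k = 1" for k
    by (simp add: Barnes_factor_def)
  have "(\<lambda>N. (\<Prod>k<N. Barnes_factor 1 k) * rGamma_series 1 N / q 1 N) \<longlonglongrightarrow>
      prodinf (Barnes_factor 1) * rGamma 1 / (exp 1 * exp ((1 - 1 / 2) * euler_mascheroni))"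
    by (intro tendsto_divide tendsto_mult Barnes_factor_partial_product_tendsto rGamma_series_LIMSEQ q_lim) simp
  moreover have "\<forall>\<^sub>F N in sequentially. q 1 N \<noteq> 0"
    using q_lim[of 1] by (rule tendsto_imp_eventually_ne) simp
  then have "\<forall>\<^sub>F N in sequentially. (\<Prod>k<N. Barnes_factor 1 k) * rGamma_series 1 N / q 1 N = st N"
    using eventually_gt_at_top[of 0]
  proof eventually_elim
    case (elim N)
    then show ?case
      using partial[of N 1] by (simp add: B0 field_simps)
  qed
  ultimately have st_lim: "st \<longlonglongrightarrow> l"
    by (simp add: l_def Lim_transform_eventually)
  show thesis
  proof (rule that[OF \<open>l \<noteq> 0\<close>])
    fix z :: complex
    have "(\<lambda>N. (\<Prod>k<N. Barnes_factor (z - 1) k) * (q z N * st N)) \<longlonglongrightarrow>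
        prodinf (Barnes_factor (z - 1)) * (exp z * exp ((z - 1 / 2) * euler_mascheroni) * l)"
      by (intro tendsto_mult Barnes_factor_partial_product_tendsto q_lim st_lim)
    moreover have "\<forall>\<^sub>F N in sequentially. (\<Prod>k<N. Barnes_factor (z - 1) k) * (q z N * st N) =
       (\<Prod>k<N. Barnes_factor z k) * rGamma_series z N"
      using eventually_gt_at_top[of 0] by eventually_elim (rule partial)
    moreover have "(\<lambda>N. (\<Prod>k<N. Barnes_factor z k) * rGamma_series z N) \<longlonglongrightarrow>
        prodinf (Barnes_factor z) * rGamma z"
      by (intro tendsto_mult Barnes_factor_partial_product_tendsto rGamma_series_LIMSEQ)
    ultimately show "prodinf (Barnes_factor (z - 1)) *
        (exp z * exp ((z - 1 / 2) * euler_mascheroni) * l) = prodinf (Barnes_factor z) * rGamma z"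
      by (rule LIMSEQ_unique[OF Lim_transform_eventually])
  qed
qed

definition Barnes_prefactor :: "complex \<Rightarrow> complex" where
  "Barnes_prefactor w = of_real (2 * pi) powr (w / 2) * exp (- (w + w\<^sup>2 * (1 + euler_mascheroni)) / 2)"

lemma Barnes_G_eq: "Barnes_G z = Barnes_prefactor (z - 1) * prodinf (Barnes_factor (z - 1))"
  unfolding Barnes_G_def Barnes_prefactor_def Barnes_factor_def Let_def ..

text \<open>The exponent of the prefactor is made to offset the exponential that the infinite
  product acquires under the shift; only the constant sqrt (2 pi) is left.\<close>

lemma Barnes_prefactor_shift:
  "Barnes_prefactor z * exp (z + (z - 1 / 2) * euler_mascheroni) =
     of_real (2 * pi) powr (1 / 2) * Barnes_prefactor (z - 1)"
proof -
  have "z / 2 = 1 / 2 + (z - 1) / 2"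
    by (simp add: field_simps)
  then have "of_real (2 * pi) powr (z / 2) = of_real (2 * pi) powr (1 / 2) * of_real (2 * pi) powr ((z - 1) / 2 :: complex)"
    by (metis powr_add)
  moreover have "exp (- (z + z\<^sup>2 * (1 + euler_mascheroni)) / 2) * exp (z + (z - 1 / 2) * euler_mascheroni) =
      exp (- ((z - 1) + (z - 1)\<^sup>2 * (1 + euler_mascheroni)) / 2 :: complex)"
    unfolding exp_add[symmetric]
    by (rule arg_cong[of _ _ exp]) (simp add: field_simps power2_eq_square)
  ultimately show ?thesis
    unfolding Barnes_prefactor_def by (simp add: mult_ac)
qed

text \<open>Here \<open>c = 1\<close>, but only \<open>c \<noteq> 0\<close> matters for growth estimates.\<close>

lemma Barnes_G_shift:
  obtains c where "c \<noteq> 0" "\<And>z. rGamma z * Barnes_G (z + 1) = c * Barnes_G z"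
proof -
  obtain l where l: "l \<noteq> 0"
    "\<And>z. prodinf (Barnes_factor (z - 1)) * (exp z * exp ((z - 1 / 2) * euler_mascheroni) * l) =
         prodinf (Barnes_factor z) * rGamma z"
    using Barnes_product_shift by blast
  show thesis
  proof (rule that[of "of_real (2 * pi) powr (1 / 2) * l"])
    show "of_real (2 * pi) powr (1 / 2) * l \<noteq> 0"
      using l(1) by (simp add: powr_def)
    fix z
    have "rGamma z * Barnes_G (z + 1) = Barnes_prefactor z * (prodinf (Barnes_factor z) * rGamma z)"
      by (simp add: Barnes_G_eq mult_ac)
    also have "\<dots> = (Barnes_prefactor z * exp (z + (z - 1 / 2) * euler_mascheroni)) *
        prodinf (Barnes_factor (z - 1)) * l"
      unfolding l(2)[symmetric] by (simp add: exp_add mult_ac)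
    also have "\<dots> = (of_real (2 * pi) powr (1 / 2) * l) * Barnes_G z"
      unfolding Barnes_prefactor_shift by (simp add: Barnes_G_eq mult_ac)
    finally show "rGamma z * Barnes_G (z + 1) = of_real (2 * pi) powr (1 / 2) * l * Barnes_G z" .
  qed
qed

lemma Barnes_G_nonzero:
  assumes "z \<notin> \<int>"
  shows "Barnes_G z \<noteq> 0"
proof -
  have "Barnes_factor (z - 1) k \<noteq> 0" for k
  proof -
    have "1 + (z - 1) / of_nat (Suc k) = (z + of_nat k) / of_nat (Suc k)"
      by (simp add: field_simps del: of_nat_Suc) simp
    moreover have "z + of_nat k \<noteq> 0"
      using assms by (metis Ints_minus Ints_of_nat add_eq_0_iff2)
    ultimately show ?thesis
      unfolding Barnes_factor_def by (simp del: of_nat_Suc)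
  qed
  then show ?thesis
    by (simp add: Barnes_G_eq Barnes_prefactor_def powr_def prodinf_nonzero[OF Barnes_factor_convergent])
qed

section \<open>Superfactorial bounds for the Barnes function along integer shifts\<close>

text \<open>For small |m| the distance from \<open>z\<close> to the closed set of integers gives the
  bound, for large |m| the triangle inequality; \<open>d\<close> is chosen so that one inequality
  covers both.\<close>

lemma Ints_distance_ge:
  fixes z :: complex
  assumes "z \<notin> \<int>"
  obtains d where "d > 0" "\<And>m::int. d * (1 + \<bar>of_int m\<bar>) \<le> norm (z + of_int m)"
proof -
  obtain e where e: "e > 0" "\<And>y. y \<in> \<int> \<Longrightarrow> e \<le> dist z y"
    using separate_point_closed[of "\<int> :: complex set" z] assms by auto
  define d where "d = e / (e + norm z + 1)"
  show thesis
  proof (rule that)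
    show "d > 0"
      using e(1) by (simp add: d_def add_pos_nonneg)
    fix m :: int
    define x where "x = norm (z + of_int m)"
    have "e \<le> x"
      using e(2)[of "- of_int m"] by (simp add: x_def dist_norm)
    have "norm (of_int m :: complex) \<le> norm (z + of_int m) + norm z"
      by (metis add_diff_cancel_left' norm_triangle_ineq4)
    then have "1 + \<bar>of_int m\<bar> \<le> x + norm z + 1"
      by (simp add: x_def)
    then have "e * (1 + \<bar>of_int m\<bar>) \<le> e * (x + norm z + 1)"
      using e(1) by (intro mult_left_mono) auto
    also have "\<dots> \<le> x * (e + norm z + 1)"
      using mult_right_mono[OF \<open>e \<le> x\<close>, of "norm z + 1"] by (simp add: algebra_simps)
    finally show "d * (1 + \<bar>of_int m\<bar>) \<le> norm (z + of_int m)"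
      using e(1) by (simp add: d_def x_def[symmetric] pos_divide_le_eq add_pos_nonneg)
  qed
qed

text \<open>The value of the Barnes function at n + 1, used as the model of its growth.\<close>

definition superfactorial :: "nat \<Rightarrow> real" where
  "superfactorial n = (\<Prod>k<n. fact k)"

lemma superfactorial_Suc: "superfactorial (Suc n) = superfactorial n * fact n"
  by (simp add: superfactorial_def)

lemma superfactorial_pos: "0 < superfactorial n"
  by (simp add: superfactorial_def prod_pos)

lemma superfactorial_mono: "m \<le> n \<Longrightarrow> superfactorial m \<le> superfactorial n"
proof (induction n rule: dec_induct)
  case (step n)
  have "superfactorial n * 1 \<le> superfactorial n * fact n"
    using superfactorial_pos[of n] by (intro mult_left_mono) auto
  then show ?case
    using step.IH by (simp add: superfactorial_Suc)
qed simp

lemma fact_square_le: "(fact k)\<^sup>2 \<le> (fact (2 * k) :: real)"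
proof -
  have "fact k * fact k dvd (fact (k + k) :: nat)"
    by (rule fact_fact_dvd_fact)
  then have "fact k * fact k \<le> (fact (k + k) :: nat)"
    by (rule dvd_imp_le) simp
  then have "real (fact k * fact k) \<le> real (fact (k + k))"
    by (rule of_nat_mono)
  then show ?thesis
    by (simp add: power2_eq_square mult_2)
qed

text \<open>The logarithm of the superfactorial is about (n^2 / 2) ln n, so doubling the index
  matches the fourth power to leading order. One step multiplies the right side by (2n)! (2n + 1)!
  and the left side by the fourth power of n!.\<close>

lemma superfactorial_power4_le: "superfactorial n ^ 4 \<le> superfactorial (2 * n)"
proof (induction n)
  case 0
  then show ?case
    by (simp add: superfactorial_def)
next
  case (Suc n)
  have "(fact n)\<^sup>2 \<le> (fact (Suc (2 * n)) :: real)"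
    using fact_square_le[of n] fact_mono[of "2 * n" "Suc (2 * n)", where 'a = real] by linarith
  then have "(fact n)\<^sup>2 * (fact n)\<^sup>2 \<le> fact (2 * n) * (fact (Suc (2 * n)) :: real)"
    by (rule mult_mono[OF fact_square_le]) simp_all
  then have "superfactorial n ^ 4 * ((fact n)\<^sup>2 * (fact n)\<^sup>2) \<le>
      superfactorial (2 * n) * (fact (2 * n) * fact (Suc (2 * n)))"
    using superfactorial_pos[of "2 * n"] by (intro mult_mono[OF Suc.IH]) auto
  then show ?case
    by (simp add: superfactorial_Suc power_mult_distrib power2_eq_square power4_eq_xxxx mult_ac del: fact_Suc)
qed

text \<open>The exponents C (1 + j) with j < k add up to at most C k^2, and the initial value is
  absorbed through \<open>g 0 \<le> exp (g 0)\<close>.\<close>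

lemma superfactorial_growth_upper:
  assumes "0 \<le> C" "0 \<le> g 0" "\<And>k. g (Suc k) \<le> exp (C * (1 + real k)) * fact k * g k"
  shows "g k \<le> exp ((C + g 0) * (1 + (real k)\<^sup>2)) * superfactorial k"
proof -
  have growth: "g k \<le> g 0 * exp (C * (real k)\<^sup>2) * superfactorial k"
  proof (induction k)
    case 0
    then show ?case
      by (simp add: superfactorial_def)
  next
    case (Suc k)
    have "g (Suc k) \<le> exp (C * (1 + real k)) * fact k * (g 0 * exp (C * (real k)\<^sup>2) * superfactorial k)"
      by (rule order_trans[OF assms(3) mult_left_mono[OF Suc.IH]]) simp
    also have "\<dots> = exp (C * (1 + real k) + C * (real k)\<^sup>2) * (g 0 * superfactorial (Suc k))"
      by (simp add: exp_add superfactorial_Suc)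
    also have "\<dots> \<le> exp (C * (real (Suc k))\<^sup>2) * (g 0 * superfactorial (Suc k))"
    proof (rule mult_right_mono)
      have "C * (1 + real k) + C * (real k)\<^sup>2 = C * (1 + real k + (real k)\<^sup>2)"
        by (simp add: algebra_simps)
      also have "\<dots> \<le> C * (real (Suc k))\<^sup>2"
        using assms(1) by (intro mult_left_mono) (auto simp: power2_eq_square algebra_simps)
      finally show "exp (C * (1 + real k) + C * (real k)\<^sup>2) \<le> exp (C * (real (Suc k))\<^sup>2)"
        by simp
      show "0 \<le> g 0 * superfactorial (Suc k)"
        using assms(2) superfactorial_pos[of "Suc k"] by simp
    qed
    finally show ?case
      by (simp add: mult_ac)
  qed
  have "g 0 * exp (C * (real k)\<^sup>2) \<le> exp (g 0) * exp (C * (real k)\<^sup>2)"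
    using order_trans[OF _ exp_ge_add_one_self, of "g 0" "g 0"] by (intro mult_right_mono) auto
  also have "\<dots> \<le> exp ((C + g 0) * (1 + (real k)\<^sup>2))"
    using assms(1,2) by (auto simp: exp_add[symmetric] algebra_simps)
  finally have "g 0 * exp (C * (real k)\<^sup>2) \<le> exp ((C + g 0) * (1 + (real k)\<^sup>2))" .
  from order_trans[OF growth mult_right_mono[OF this]] show ?thesis
    by (simp add: superfactorial_pos less_imp_le)
qed

lemma superfactorial_growth_lower:
  assumes "0 \<le> C" "0 < g 0" "\<And>k. exp (- C * (1 + real k)) * fact k * g k \<le> g (Suc k)"
  shows "exp (- (C + \<bar>ln (g 0)\<bar>) * (1 + (real k)\<^sup>2)) * superfactorial k \<le> g k"
proof -
  have growth: "g 0 * exp (- C * (real k)\<^sup>2) * superfactorial k \<le> g k"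
  proof (induction k)
    case 0
    then show ?case
      by (simp add: superfactorial_def)
  next
    case (Suc k)
    have "exp (- C * (real (Suc k))\<^sup>2) * (g 0 * superfactorial (Suc k)) \<le>
        exp (- C * (1 + real k) + - C * (real k)\<^sup>2) * (g 0 * superfactorial (Suc k))"
    proof (rule mult_right_mono)
      have "C * (1 + real k) + C * (real k)\<^sup>2 = C * (1 + real k + (real k)\<^sup>2)"
        by (simp add: algebra_simps)
      also have "\<dots> \<le> C * (real (Suc k))\<^sup>2"
        using assms(1) by (intro mult_left_mono) (auto simp: power2_eq_square algebra_simps)
      finally show "exp (- C * (real (Suc k))\<^sup>2) \<le> exp (- C * (1 + real k) + - C * (real k)\<^sup>2)"
        by simp
      show "0 \<le> g 0 * superfactorial (Suc k)"
        using assms(2) superfactorial_pos[of "Suc k"] by simp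
    qed
    also have "\<dots> = exp (- C * (1 + real k)) * fact k * (g 0 * exp (- C * (real k)\<^sup>2) * superfactorial k)"
      unfolding exp_add superfactorial_Suc by (simp add: mult_ac)
    also have "\<dots> \<le> g (Suc k)"
      by (rule order_trans[OF mult_left_mono[OF Suc.IH] assms(3)]) simp
    finally show ?case
      by (simp add: mult_ac)
  qed
  have "exp (- \<bar>ln (g 0)\<bar>) \<le> g 0"
    using assms(2) by (subst ln_ge_iff[symmetric]) auto
  then have "exp (- \<bar>ln (g 0)\<bar> + - C * (real k)\<^sup>2) \<le> g 0 * exp (- C * (real k)\<^sup>2)"
    unfolding exp_add by (intro mult_right_mono) auto
  moreover have "exp (- (C + \<bar>ln (g 0)\<bar>) * (1 + (real k)\<^sup>2)) \<le> exp (- \<bar>ln (g 0)\<bar> + - C * (real k)\<^sup>2)"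
    using assms(1) by (simp add: algebra_simps) (rule order_trans[of _ 0], simp_all)
  ultimately have "exp (- (C + \<bar>ln (g 0)\<bar>) * (1 + (real k)\<^sup>2)) \<le> g 0 * exp (- C * (real k)\<^sup>2)"
    by linarith
  from order_trans[OF mult_right_mono[OF this] growth] show ?thesis
    by (simp add: superfactorial_pos less_imp_le)
qed

lemma pochhammer_mult_rGamma: "pochhammer z k * rGamma (z + of_nat k) = rGamma (z :: complex)"
proof (induction k)
  case (Suc k)
  have "(z + of_nat k) * rGamma (z + of_nat (Suc k)) = rGamma (z + of_nat k)"
    using rGamma_plus1[of "z + of_nat k"] by (simp add: add_ac)
  then show ?case
    using Suc.IH by (simp add: pochhammer_Suc mult.assoc)
qed simp

lemma rGamma_minus_of_nat_eq:
  "rGamma (z - of_nat k) = (- 1) ^ k * pochhammer (1 - z) k * rGamma (z :: complex)"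
proof (induction k)
  case (Suc k)
  have "rGamma (z - of_nat (Suc k)) = (z - of_nat (Suc k)) * rGamma (z - of_nat k)"
    using rGamma_plus1[of "z - of_nat (Suc k)"] by (simp add: algebra_simps)
  then show ?case
    using Suc.IH by (simp add: pochhammer_Suc algebra_simps)
qed simp

lemma norm_pochhammer_le: "norm (pochhammer b k) \<le> exp (real k * norm b) * fact k" for b :: complex
proof (induction k)
  case (Suc k)
  have "norm (b + of_nat k) \<le> norm b + real k"
    by (metis norm_of_nat norm_triangle_ineq)
  also have "\<dots> \<le> (1 + norm b) * (1 + real k)"
    by (simp add: algebra_simps)
  also have "\<dots> \<le> exp (norm b) * (1 + real k)"
    by (intro mult_right_mono exp_ge_add_one_self) auto
  finally have "norm (pochhammer b k) * norm (b + of_nat k) \<le>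
      (exp (real k * norm b) * fact k) * (exp (norm b) * (1 + real k))"
    using Suc.IH by (intro mult_mono) auto
  then show ?case
    unfolding pochhammer_Suc norm_mult by (simp add: exp_add algebra_simps)
qed simp

lemma norm_pochhammer_ge:
  fixes b :: complex
  assumes "b \<notin> \<int>"
  obtains C where "0 \<le> C" "\<And>k. exp (- C * real k) * fact k \<le> norm (pochhammer b k)"
proof -
  obtain d where d: "d > 0" "\<And>m::int. d * (1 + \<bar>of_int m\<bar>) \<le> norm (b + of_int m)"
    using Ints_distance_ge[OF assms] by blast
  define C where "C = \<bar>ln d\<bar>"
  have eC: "exp (- C) \<le> d"
    using d(1) unfolding C_def by (subst ln_ge_iff[symmetric]) auto
  show thesis
  proof (rule that)
    fix k
    show "exp (- C * real k) * fact k \<le> norm (pochhammer b k)"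
    proof (induction k)
      case (Suc k)
      have "exp (- C) * (1 + real k) \<le> d * (1 + real k)"
        using eC by (intro mult_right_mono) auto
      also have "\<dots> \<le> norm (b + of_nat k)"
        using d(2)[of "int k"] by simp
      finally have "(exp (- C * real k) * fact k) * (exp (- C) * (1 + real k)) \<le>
          norm (pochhammer b k) * norm (b + of_nat k)"
        using Suc.IH by (intro mult_mono) auto
      moreover have "exp (- C * real (Suc k)) = exp (- C * real k) * exp (- C)"
        by (simp add: exp_add[symmetric] algebra_simps)
      ultimately show ?case
        unfolding pochhammer_Suc norm_mult by (simp add: mult_ac)
    qed simp
  qed (simp add: C_def)
qed

text \<open>The Gamma value at the moving point is reduced to the one at \<open>b\<close> and a
  Pochhammer symbol, which grows like k!. Solving upwards divides by \<open>rGamma b\<close>,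
  solving downwards only by \<open>c\<close>; this is why the upper bounds need a condition on
  \<open>b\<close> in the upward direction alone.\<close>

lemma norm_Barnes_G_recurrences:
  obtains c :: real where "c > 0"
    "\<And>b k. norm (Barnes_G (b + of_nat (Suc k))) * norm (rGamma b) =
       c * norm (pochhammer b k) * norm (Barnes_G (b + of_nat k))"
    "\<And>b k. norm (Barnes_G (b - of_nat (Suc k))) * c =
       norm (rGamma b) * norm (pochhammer (1 - b) (Suc k)) * norm (Barnes_G (b - of_nat k))"
proof -
  obtain c where c: "c \<noteq> 0" "\<And>z. rGamma z * Barnes_G (z + 1) = c * Barnes_G z"
    using Barnes_G_shift by blast
  show thesis
  proof (rule that[of "norm c"])
    fix b :: complex and k :: nat
    have "pochhammer b k * (rGamma (b + of_nat k) * Barnes_G (b + of_nat k + 1)) =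
        pochhammer b k * (c * Barnes_G (b + of_nat k))"
      unfolding c(2) ..
    then have "Barnes_G (b + of_nat (Suc k)) * rGamma b = c * pochhammer b k * Barnes_G (b + of_nat k)"
      unfolding pochhammer_mult_rGamma[of b k, symmetric] by (simp add: mult_ac add_ac)
    then show "norm (Barnes_G (b + of_nat (Suc k))) * norm (rGamma b) =
       norm c * norm (pochhammer b k) * norm (Barnes_G (b + of_nat k))"
      by (metis norm_mult)
    have "Barnes_G (b - of_nat (Suc k)) * c =
        rGamma (b - of_nat (Suc k)) * Barnes_G (b - of_nat k)"
      using c(2)[of "b - of_nat (Suc k)"] by (simp add: algebra_simps)
    then have "norm (Barnes_G (b - of_nat (Suc k)) * c) =
        norm (rGamma (b - of_nat (Suc k)) * Barnes_G (b - of_nat k))"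
      by simp
    then show "norm (Barnes_G (b - of_nat (Suc k))) * norm c =
       norm (rGamma b) * norm (pochhammer (1 - b) (Suc k)) * norm (Barnes_G (b - of_nat k))"
      unfolding rGamma_minus_of_nat_eq norm_mult norm_power by (simp add: mult_ac)
  qed (use c(1) in simp)
qed

lemma norm_Barnes_G_up_le:
  assumes "b \<notin> \<int>\<^sub>\<le>\<^sub>0"
  obtains C where "0 \<le> C"
    "\<And>k. norm (Barnes_G (b + of_nat k)) \<le> exp (C * (1 + (real k)\<^sup>2)) * superfactorial k"
proof -
  obtain c :: real where c: "c > 0" "\<And>b k. norm (Barnes_G (b + of_nat (Suc k))) * norm (rGamma b) =
       c * norm (pochhammer b k) * norm (Barnes_G (b + of_nat k))"
    using norm_Barnes_G_recurrences by metis
  define A where "A = c / norm (rGamma b)"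
  have r: "norm (rGamma b) > 0"
    using assms by (simp add: rGamma_eq_zero_iff)
  have A: "A > 0"
    using c r by (simp add: A_def)
  define C where "C = A + norm b"
  define g where "g k = norm (Barnes_G (b + of_nat k))" for k
  have C: "0 \<le> C"
    using A by (simp add: C_def)
  have "g (Suc k) \<le> exp (C * (1 + real k)) * fact k * g k" for k
  proof -
    have "g (Suc k) = A * norm (pochhammer b k) * g k"
      using c(2)[of b k] r by (simp add: g_def A_def field_simps)
    also have "\<dots> \<le> exp A * (exp (real k * norm b) * fact k) * g k"
      using A order_trans[OF _ exp_ge_add_one_self, of A A] norm_pochhammer_le[of b k]
      by (intro mult_right_mono mult_mono) (auto simp: g_def)
    also have "\<dots> = exp (A + real k * norm b) * fact k * g k"
      by (simp add: exp_add)
    also have "\<dots> \<le> exp (C * (1 + real k)) * fact k * g k"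
      using A by (intro mult_right_mono) (auto simp: g_def C_def algebra_simps)
    finally show ?thesis .
  qed
  then have "g k \<le> exp ((C + g 0) * (1 + (real k)\<^sup>2)) * superfactorial k" for k
    using C by (intro superfactorial_growth_upper) (auto simp: g_def)
  then show thesis
    using C by (intro that[of "C + g 0"]) (auto simp: g_def)
qed

lemma norm_Barnes_G_down_le:
  obtains C where "0 \<le> C"
    "\<And>k. norm (Barnes_G (b - of_nat k)) \<le> exp (C * (1 + (real k)\<^sup>2)) * superfactorial k"
proof -
  obtain c :: real where c: "c > 0" "\<And>b k. norm (Barnes_G (b - of_nat (Suc k))) * c =
       norm (rGamma b) * norm (pochhammer (1 - b) (Suc k)) * norm (Barnes_G (b - of_nat k))"
    using norm_Barnes_G_recurrences by metis
  define A where "A = norm (rGamma b) / c"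
  have A: "A \<ge> 0"
    using c by (simp add: A_def)
  \<comment> \<open>The summand 1 pays for the extra factor k + 1 in
    \<open>fact (Suc k)\<close>.\<close>
  define C where "C = A + norm (1 - b) + 1"
  define g where "g k = norm (Barnes_G (b - of_nat k))" for k
  have C: "0 \<le> C"
    using A by (simp add: C_def)
  have "g (Suc k) \<le> exp (C * (1 + real k)) * fact k * g k" for k
  proof -
    have "fact (Suc k) \<le> exp (real k) * (fact k :: real)"
      using exp_ge_add_one_self[of "real k"] by (simp add: mult_right_mono add.commute)
    then have p: "norm (pochhammer (1 - b) (Suc k)) \<le> exp (real (Suc k) * norm (1 - b)) * (exp (real k) * fact k)"
      using norm_pochhammer_le[of "1 - b" "Suc k"] by (meson mult_left_mono exp_ge_zero order_trans)
    have "g (Suc k) = A * norm (pochhammer (1 - b) (Suc k)) * g k"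
      using c(2)[of b k] c(1) by (simp add: g_def A_def field_simps)
    also have "\<dots> \<le> exp A * (exp (real (Suc k) * norm (1 - b)) * (exp (real k) * fact k)) * g k"
      using A order_trans[OF _ exp_ge_add_one_self, of A A] p
      by (intro mult_right_mono mult_mono) (auto simp: g_def)
    also have "\<dots> = exp (A + real (Suc k) * norm (1 - b) + real k) * fact k * g k"
      by (simp add: exp_add)
    also have "\<dots> \<le> exp (C * (1 + real k)) * fact k * g k"
      using A by (intro mult_right_mono) (auto simp: g_def C_def algebra_simps)
    finally show ?thesis .
  qed
  then have "g k \<le> exp ((C + g 0) * (1 + (real k)\<^sup>2)) * superfactorial k" for k
    using C by (intro superfactorial_growth_upper) (auto simp: g_def)
  then show thesis
    using C by (intro that[of "C + g 0"]) (auto simp: g_def)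
qed

lemma norm_Barnes_G_up_ge:
  assumes "b \<notin> \<int>"
  obtains C where "0 \<le> C"
    "\<And>k. exp (- C * (1 + (real k)\<^sup>2)) * superfactorial k \<le> norm (Barnes_G (b + of_nat k))"
proof -
  obtain c :: real where c: "c > 0" "\<And>b k. norm (Barnes_G (b + of_nat (Suc k))) * norm (rGamma b) =
       c * norm (pochhammer b k) * norm (Barnes_G (b + of_nat k))"
    using norm_Barnes_G_recurrences by metis
  obtain P where P: "0 \<le> P" "\<And>k. exp (- P * real k) * fact k \<le> norm (pochhammer b k)"
    using norm_pochhammer_ge[OF assms] by blast
  define A where "A = c / norm (rGamma b)"
  have r: "norm (rGamma b) > 0"
    using assms by (auto simp: rGamma_eq_zero_iff elim!: nonpos_Ints_cases)
  have A: "A > 0"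
    using c r by (simp add: A_def)
  have eA: "exp (- \<bar>ln A\<bar>) \<le> A"
    using A by (subst ln_ge_iff[symmetric]) auto
  define C where "C = \<bar>ln A\<bar> + P"
  define g where "g k = norm (Barnes_G (b + of_nat k))" for k
  have C: "0 \<le> C"
    using P by (simp add: C_def)
  have "exp (- C * (1 + real k)) * fact k * g k \<le> g (Suc k)" for k
  proof -
    have "- C * (1 + real k) \<le> - \<bar>ln A\<bar> + - P * real k"
      using P by (simp add: C_def algebra_simps) (rule order_trans[of _ 0], simp_all)
    then have "exp (- C * (1 + real k)) * fact k * g k \<le> exp (- \<bar>ln A\<bar> + - P * real k) * fact k * g k"
      by (intro mult_right_mono) (auto simp: g_def)
    also have "\<dots> = exp (- \<bar>ln A\<bar>) * (exp (- P * real k) * fact k) * g k"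
      by (simp only: exp_add mult.assoc)
    also have "\<dots> \<le> A * norm (pochhammer b k) * g k"
      using A eA P(2)[of k] by (intro mult_right_mono mult_mono) (auto simp: g_def)
    also have "\<dots> = g (Suc k)"
      using c(2)[of b k] r by (simp add: g_def A_def field_simps)
    finally show ?thesis .
  qed
  moreover have "g 0 > 0"
    using Barnes_G_nonzero[OF assms] by (simp add: g_def)
  ultimately have "exp (- (C + \<bar>ln (g 0)\<bar>) * (1 + (real k)\<^sup>2)) * superfactorial k \<le> g k" for k
    using C by (intro superfactorial_growth_lower) auto
  then show thesis
    using C by (intro that[of "C + \<bar>ln (g 0)\<bar>"]) (auto simp: g_def)
qed

lemma norm_Barnes_G_down_ge:
  assumes "b \<notin> \<int>"
  obtains C where "0 \<le> C"
    "\<And>k. exp (- C * (1 + (real k)\<^sup>2)) * superfactorial k \<le> norm (Barnes_G (b - of_nat k))"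
proof -
  obtain c :: real where c: "c > 0" "\<And>b k. norm (Barnes_G (b - of_nat (Suc k))) * c =
       norm (rGamma b) * norm (pochhammer (1 - b) (Suc k)) * norm (Barnes_G (b - of_nat k))"
    using norm_Barnes_G_recurrences by metis
  have "1 - b \<notin> \<int>"
    using assms by (metis Ints_1 Ints_diff add_diff_cancel_left' diff_add_cancel diff_diff_eq2)
  then obtain P where P: "0 \<le> P" "\<And>k. exp (- P * real k) * fact k \<le> norm (pochhammer (1 - b) k)"
    using norm_pochhammer_ge by blast
  define A where "A = norm (rGamma b) / c"
  have r: "norm (rGamma b) > 0"
    using assms by (auto simp: rGamma_eq_zero_iff elim!: nonpos_Ints_cases)
  have A: "A > 0"
    using c r by (simp add: A_def)
  have eA: "exp (- \<bar>ln A\<bar>) \<le> A"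
    using A by (subst ln_ge_iff[symmetric]) auto
  define C where "C = \<bar>ln A\<bar> + P"
  define g where "g k = norm (Barnes_G (b - of_nat k))" for k
  have C: "0 \<le> C"
    using P by (simp add: C_def)
  have "exp (- C * (1 + real k)) * fact k * g k \<le> g (Suc k)" for k
  proof -
    have "fact k \<le> (fact (Suc k) :: real)"
      by (rule fact_mono) simp
    then have p: "exp (- P * real (Suc k)) * fact k \<le> norm (pochhammer (1 - b) (Suc k))"
      using P(2)[of "Suc k"] by (meson mult_left_mono exp_ge_zero order_trans)
    have "- C * (1 + real k) \<le> - \<bar>ln A\<bar> + - P * real (Suc k)"
      by (simp add: C_def algebra_simps)
    then have "exp (- C * (1 + real k)) * fact k * g k \<le> exp (- \<bar>ln A\<bar> + - P * real (Suc k)) * fact k * g k"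
      by (intro mult_right_mono) (auto simp: g_def)
    also have "\<dots> = exp (- \<bar>ln A\<bar>) * (exp (- P * real (Suc k)) * fact k) * g k"
      by (simp only: exp_add mult.assoc)
    also have "\<dots> \<le> A * norm (pochhammer (1 - b) (Suc k)) * g k"
      using A eA p by (intro mult_right_mono mult_mono) (auto simp: g_def)
    also have "\<dots> = g (Suc k)"
      using c(2)[of b k] c(1) by (simp add: g_def A_def field_simps)
    finally show ?thesis .
  qed
  moreover have "g 0 > 0"
    using Barnes_G_nonzero[OF assms] by (simp add: g_def)
  ultimately have "exp (- (C + \<bar>ln (g 0)\<bar>) * (1 + (real k)\<^sup>2)) * superfactorial k \<le> g k" for k
    using C by (intro superfactorial_growth_lower) auto
  then show thesis
    using C by (intro that[of "C + \<bar>ln (g 0)\<bar>"]) (auto simp: g_def)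
qed

section \<open>Growth of order exp(O(n^2)) and the structure constants\<close>

text \<open>The summand 1 leaves room for an arbitrary value at n = 0.\<close>

definition quadratic_growth :: "(int \<Rightarrow> complex) \<Rightarrow> bool" where
  "quadratic_growth f \<longleftrightarrow> (\<exists>C. \<forall>n. norm (f n) \<le> exp (C * (1 + (of_int n)\<^sup>2)))"

lemma quadratic_growthI:
  "(\<And>n. norm (f n) \<le> exp (C * (1 + (of_int n)\<^sup>2))) \<Longrightarrow> quadratic_growth f"
  unfolding quadratic_growth_def by blast

lemma quadratic_growth_const: "quadratic_growth (\<lambda>_. c)"
proof (rule quadratic_growthI)
  fix n :: int
  have "norm c \<le> exp (norm c)"
    by (rule order_trans[OF _ exp_ge_add_one_self]) simp
  also have "\<dots> \<le> exp (norm c * (1 + (of_int n)\<^sup>2))"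
    by (simp add: algebra_simps)
  finally show "norm c \<le> exp (norm c * (1 + (of_int n)\<^sup>2))" .
qed

lemma quadratic_growth_mult:
  assumes "quadratic_growth f" "quadratic_growth g"
  shows "quadratic_growth (\<lambda>n. f n * g n)"
proof -
  obtain C D where "norm (f n) \<le> exp (C * (1 + (of_int n)\<^sup>2))" "norm (g n) \<le> exp (D * (1 + (of_int n)\<^sup>2))" for n
    using assms unfolding quadratic_growth_def by blast
  then have "norm (f n * g n) \<le> exp (C * (1 + (of_int n)\<^sup>2)) * exp (D * (1 + (of_int n)\<^sup>2))" for n
    unfolding norm_mult by (intro mult_mono) auto
  then show ?thesis
    by (intro quadratic_growthI[of _ "C + D"]) (simp add: exp_add algebra_simps)
qed

lemma quadratic_growth_minus:
  assumes "quadratic_growth f"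
  shows "quadratic_growth (\<lambda>n. f (- n))"
proof -
  obtain C where C: "norm (f n) \<le> exp (C * (1 + (of_int n)\<^sup>2))" for n
    using assms unfolding quadratic_growth_def by blast
  show ?thesis
    using C[of "- n" for n] by (intro quadratic_growthI[of _ C]) simp
qed

lemma Barnes_G_nonpos_Int:
  assumes "z \<in> \<int>\<^sub>\<le>\<^sub>0"
  shows "Barnes_G z = 0"
proof -
  obtain c where "c \<noteq> 0" "rGamma z * Barnes_G (z + 1) = c * Barnes_G z"
    using Barnes_G_shift by metis
  moreover have "rGamma z = 0"
    using assms by (simp add: rGamma_eq_zero_iff)
  ultimately show ?thesis
    by simp
qed

lemma norm_Barnes_G_int_le:
  obtains C where "0 \<le> C"
    "\<And>n::int. norm (Barnes_G (b + of_int n)) \<le> exp (C * (1 + (of_int n)\<^sup>2)) * superfactorial (nat \<bar>n\<bar>)"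
proof -
  obtain D where D: "0 \<le> D"
    "\<And>k. norm (Barnes_G (b - of_nat k)) \<le> exp (D * (1 + (real k)\<^sup>2)) * superfactorial k"
    using norm_Barnes_G_down_le by blast
  obtain U where U: "0 \<le> U"
    "\<And>k. norm (Barnes_G (b + of_nat k)) \<le> exp (U * (1 + (real k)\<^sup>2)) * superfactorial k"
  proof (cases "b \<in> \<int>\<^sub>\<le>\<^sub>0")
    case False
    then show ?thesis
      using norm_Barnes_G_up_le that by blast
  next
    case True
    \<comment> \<open>From a nonpositive integer the shifts meet zeros of the Barnes function until
      the argument reaches 1; from there on they follow the sequence based at 1, with a smaller
      index.\<close>
    then obtain j where b: "b = of_int j" "j \<le> 0"
      by (auto elim: nonpos_Ints_cases)
    obtain U where U: "0 \<le> U"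
      "\<And>k. norm (Barnes_G (1 + of_nat k)) \<le> exp (U * (1 + (real k)\<^sup>2)) * superfactorial k"
      using norm_Barnes_G_up_le[of 1] by (auto elim: nonpos_Ints_cases)
    show ?thesis
    proof (rule that[OF U(1)])
      fix k
      show "norm (Barnes_G (b + of_nat k)) \<le> exp (U * (1 + (real k)\<^sup>2)) * superfactorial k"
      proof (cases "j + int k \<le> 0")
        case True
        then have "b + of_nat k \<in> \<int>\<^sub>\<le>\<^sub>0"
          unfolding b by (metis nonpos_Ints_of_int of_int_add of_int_of_nat_eq)
        then show ?thesis
          using superfactorial_pos[of k] by (simp add: Barnes_G_nonpos_Int less_imp_le)
      next
        case False
        define i where "i = nat (j + int k - 1)"
        have i: "int i = j + int k - 1" "i \<le> k"
          using False b(2) by (auto simp: i_def)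
        have "b + of_nat k = 1 + of_nat i"
          using arg_cong[OF i(1), of "of_int :: int \<Rightarrow> complex"] by (simp add: b)
        then have "norm (Barnes_G (b + of_nat k)) \<le> exp (U * (1 + (real i)\<^sup>2)) * superfactorial i"
          using U(2)[of i] by simp
        also have "\<dots> \<le> exp (U * (1 + (real k)\<^sup>2)) * superfactorial k"
          using U(1) i(2) superfactorial_mono[OF i(2)] superfactorial_pos[of i]
          by (intro mult_mono) (auto intro!: mult_left_mono simp: less_imp_le)
        finally show ?thesis .
      qed
    qed
  qed
  show thesis
  proof (rule that[of "U + D"])
    fix n :: int
    have le: "exp (U * (1 + (of_int n)\<^sup>2)) \<le> exp ((U + D) * (1 + (of_int n)\<^sup>2))"
      "exp (D * (1 + (of_int n)\<^sup>2)) \<le> exp ((U + D) * (1 + (of_int n)\<^sup>2))"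
      using U(1) D(1) by (auto intro!: mult_right_mono)
    show "norm (Barnes_G (b + of_int n)) \<le> exp ((U + D) * (1 + (of_int n)\<^sup>2)) * superfactorial (nat \<bar>n\<bar>)"
    proof (cases "n \<ge> 0")
      case True
      then have "norm (Barnes_G (b + of_int n)) \<le> exp (U * (1 + (of_int n)\<^sup>2)) * superfactorial (nat \<bar>n\<bar>)"
        using U(2)[of "nat n"] by simp
      then show ?thesis
        by (rule order_trans[OF _ mult_right_mono[OF le(1)]]) (simp add: superfactorial_pos less_imp_le)
    next
      case False
      then have "norm (Barnes_G (b + of_int n)) \<le> exp (D * (1 + (of_int n)\<^sup>2)) * superfactorial (nat \<bar>n\<bar>)"
        using D(2)[of "nat (- n)"] by simp
      then show ?thesis
        by (rule order_trans[OF _ mult_right_mono[OF le(2)]]) (simp add: superfactorial_pos less_imp_le)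
    qed
  qed (use U(1) D(1) in simp)
qed

lemma norm_Barnes_G_int_ge:
  assumes "b \<notin> \<int>"
  obtains C where "0 \<le> C"
    "\<And>n::int. exp (- C * (1 + (of_int n)\<^sup>2)) * superfactorial (nat \<bar>n\<bar>) \<le> norm (Barnes_G (b + of_int n))"
proof -
  obtain D where D: "0 \<le> D"
    "\<And>k. exp (- D * (1 + (real k)\<^sup>2)) * superfactorial k \<le> norm (Barnes_G (b - of_nat k))"
    using norm_Barnes_G_down_ge[OF assms] by blast
  obtain U where U: "0 \<le> U"
    "\<And>k. exp (- U * (1 + (real k)\<^sup>2)) * superfactorial k \<le> norm (Barnes_G (b + of_nat k))"
    using norm_Barnes_G_up_ge[OF assms] by blast
  show thesis
  proof (rule that[of "U + D"])
    fix n :: int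
    have le: "exp (- (U + D) * (1 + (of_int n)\<^sup>2)) \<le> exp (- U * (1 + (of_int n)\<^sup>2))"
      "exp (- (U + D) * (1 + (of_int n)\<^sup>2)) \<le> exp (- D * (1 + (of_int n)\<^sup>2))"
      unfolding exp_le_cancel_iff by (rule mult_right_mono; use U(1) D(1) in simp)+
    show "exp (- (U + D) * (1 + (of_int n)\<^sup>2)) * superfactorial (nat \<bar>n\<bar>) \<le> norm (Barnes_G (b + of_int n))"
    proof (cases "n \<ge> 0")
      case True
      then have "exp (- U * (1 + (of_int n)\<^sup>2)) * superfactorial (nat \<bar>n\<bar>) \<le> norm (Barnes_G (b + of_int n))"
        using U(2)[of "nat n"] by simp
      then show ?thesis
        by (rule order_trans[OF mult_right_mono[OF le(1) less_imp_le[OF superfactorial_pos]]])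
    next
      case False
      then have "exp (- D * (1 + (of_int n)\<^sup>2)) * superfactorial (nat \<bar>n\<bar>) \<le> norm (Barnes_G (b + of_int n))"
        using D(2)[of "nat (- n)"] by simp
      then show ?thesis
        by (rule order_trans[OF mult_right_mono[OF le(2) less_imp_le[OF superfactorial_pos]]])
    qed
  qed (use U(1) D(1) in simp)
qed

lemma quadratic_growth_Barnes_G:
  "quadratic_growth (\<lambda>n. Barnes_G (b + of_int n) / of_real (superfactorial (nat \<bar>n\<bar>)))"
proof -
  obtain C where "\<And>n::int. norm (Barnes_G (b + of_int n)) \<le> exp (C * (1 + (of_int n)\<^sup>2)) * superfactorial (nat \<bar>n\<bar>)"
    using norm_Barnes_G_int_le by blast
  then show ?thesis
    by (intro quadratic_growthI[of _ C])
       (simp add: norm_divide superfactorial_pos pos_divide_le_eq less_imp_le)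
qed

text \<open>The denominators with argument 1 + 2 \<sigma> or 1 - 2 \<sigma> move in steps of two.
  Each is as large as a superfactorial of index 2 |n| and can therefore pay for four of index
  |n|.\<close>

lemma quadratic_growth_inverse_Barnes_G:
  assumes "b \<notin> \<int>"
  shows "quadratic_growth (\<lambda>n. of_real (superfactorial (nat \<bar>n\<bar>) ^ 4) / Barnes_G (b + of_int (2 * n)))"
proof -
  obtain C where C: "0 \<le> C" "\<And>n::int. exp (- C * (1 + (of_int n)\<^sup>2)) * superfactorial (nat \<bar>n\<bar>) \<le>
      norm (Barnes_G (b + of_int n))"
    using norm_Barnes_G_int_ge[OF assms] by blast
  show ?thesis
  proof (rule quadratic_growthI[of _ "4 * C"])
    fix n :: int
    define B where "B = norm (Barnes_G (b + of_int (2 * n)))"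
    have "b + of_int (2 * n) \<notin> \<int>"
      using assms Ints_diff[of "b + of_int (2 * n)" "of_int (2 * n)"] by auto
    then have B: "B > 0"
      using Barnes_G_nonzero by (simp add: B_def)
    have two: "nat \<bar>2 * n\<bar> = 2 * nat \<bar>n\<bar>"
      by (simp add: abs_mult nat_mult_distrib)
    have "superfactorial (nat \<bar>n\<bar>) ^ 4 \<le> superfactorial (nat \<bar>2 * n\<bar>)"
      unfolding two by (rule superfactorial_power4_le)
    also have "\<dots> = exp (C * (1 + (of_int (2 * n))\<^sup>2)) * (exp (- C * (1 + (of_int (2 * n))\<^sup>2)) * superfactorial (nat \<bar>2 * n\<bar>))"
      by (simp add: exp_minus)
    also have "\<dots> \<le> exp (C * (1 + (of_int (2 * n))\<^sup>2)) * B"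
      unfolding B_def by (intro mult_left_mono C(2)) simp
    also have "\<dots> \<le> exp (4 * C * (1 + (of_int n)\<^sup>2)) * B"
      using C(1) B by (intro mult_right_mono) (auto simp: power2_eq_square algebra_simps)
    finally show "norm (of_real (superfactorial (nat \<bar>n\<bar>) ^ 4) / Barnes_G (b + of_int (2 * n)))
        \<le> exp (4 * C * (1 + (of_int n)\<^sup>2))"
      using B superfactorial_pos[of "nat \<bar>n\<bar>"] unfolding norm_divide B_def[symmetric]
      by (simp add: norm_power pos_divide_le_eq abs_of_pos)
  qed
qed

text \<open>Eight numerator factors move by one with n and two denominators by two, so the
  superfactorials cancel as 8 = 2 * 4.\<close>

lemma quadratic_growth_structure_const:
  assumes "2 * \<sigma> \<notin> \<int>"
  shows "quadratic_growth (\<lambda>n. structure_const \<theta>1 \<theta>inf (\<sigma> + of_int n) * structure_const \<theta>t (\<sigma> + of_int n) \<theta>0)"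
proof -
  define S where "S n = (of_real (superfactorial (nat \<bar>n\<bar>)) :: complex)" for n :: int
  define g where "g b n = Barnes_G (b + of_int n) / S n" for b n
  define h where "h b n = S n ^ 4 / Barnes_G (b + of_int (2 * n))" for b n
  \<comment> \<open>The denominators free of \<sigma>. If one of them vanishes, both sides of the
    factorization below are 0 by the convention for division.\<close>
  define K where "K = 1 / (Barnes_G (1 - 2 * \<theta>1) * Barnes_G (1 + 2 * \<theta>inf) *
      Barnes_G (1 - 2 * \<theta>0) * Barnes_G (1 - 2 * \<theta>t))"
  have S: "S n \<noteq> 0" "S (- n) = S n" for n
    using superfactorial_pos[of "nat \<bar>n\<bar>"] by (simp_all add: S_def)
  have up: "Barnes_G (b + of_int n) = g b n * S n" and down: "Barnes_G (b - of_int n) = g b (- n) * S n" for b n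
    using S(1)[of n] S(1)[of "- n"] S(2)[of n] by (simp_all add: g_def)
  have g: "quadratic_growth (g b)" for b
    unfolding g_def S_def by (rule quadratic_growth_Barnes_G)
  have h: "quadratic_growth (h b)" if "b \<notin> \<int>" for b
    using quadratic_growth_inverse_Barnes_G[OF that] unfolding h_def S_def by simp
  have sig: "1 + 2 * \<sigma> \<notin> \<int>" "1 - 2 * \<sigma> \<notin> \<int>"
    using assms Ints_diff[of "1 + 2 * \<sigma>" 1] Ints_diff[of 1 "1 - 2 * \<sigma>"] by auto
  have "structure_const \<theta>1 \<theta>inf (\<sigma> + of_int n) * structure_const \<theta>t (\<sigma> + of_int n) \<theta>0 =
     K * (g (1 + \<theta>inf + (\<sigma> + \<theta>1)) n * g (1 - \<theta>inf + (\<sigma> - \<theta>1)) n *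
      (g (1 + \<theta>inf - (\<sigma> + \<theta>1)) (- n) * g (1 - \<theta>inf - (\<sigma> - \<theta>1)) (- n)) *
      (g (1 + \<sigma> + (\<theta>0 + \<theta>t)) n * g (1 - \<sigma> + (\<theta>0 - \<theta>t)) (- n) *
      (g (1 + \<sigma> - (\<theta>0 + \<theta>t)) n * g (1 - \<sigma> - (\<theta>0 - \<theta>t)) (- n)))) *
      h (1 + 2 * \<sigma>) n * h (1 - 2 * \<sigma>) (- n)" for n
  proof -
    have e: "1 + \<theta>inf + (\<sigma> + of_int n + \<theta>1) = 1 + \<theta>inf + (\<sigma> + \<theta>1) + of_int n"
      "1 - \<theta>inf + (\<sigma> + of_int n - \<theta>1) = 1 - \<theta>inf + (\<sigma> - \<theta>1) + of_int n"
      "1 + \<theta>inf + - (\<sigma> + of_int n + \<theta>1) = 1 + \<theta>inf - (\<sigma> + \<theta>1) - of_int n"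
      "1 - \<theta>inf + - (\<sigma> + of_int n - \<theta>1) = 1 - \<theta>inf - (\<sigma> - \<theta>1) - of_int n"
      "1 + (\<sigma> + of_int n) + (\<theta>0 + \<theta>t) = 1 + \<sigma> + (\<theta>0 + \<theta>t) + of_int n"
      "1 - (\<sigma> + of_int n) + (\<theta>0 - \<theta>t) = 1 - \<sigma> + (\<theta>0 - \<theta>t) - of_int n"
      "1 + (\<sigma> + of_int n) + - (\<theta>0 + \<theta>t) = 1 + \<sigma> - (\<theta>0 + \<theta>t) + of_int n"
      "1 - (\<sigma> + of_int n) + - (\<theta>0 - \<theta>t) = 1 - \<sigma> - (\<theta>0 - \<theta>t) - of_int n"
      "1 - 2 * (\<sigma> + of_int n) = 1 - 2 * \<sigma> + of_int (2 * (- n))"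
      "1 + 2 * (\<sigma> + of_int n) = 1 + 2 * \<sigma> + of_int (2 * n)"
      by (simp_all add: algebra_simps)
    have prod: "(\<Prod>\<epsilon>\<in>{1, -1 :: complex}. f \<epsilon>) = f 1 * f (- 1)" for f :: "complex \<Rightarrow> complex"
      by simp
    show ?thesis
      unfolding structure_const_def prod mult_1 mult_minus1 e up down h_def K_def S(2)
      by (simp add: power4_eq_xxxx mult_ac)
  qed
  then show ?thesis
    using g h[OF sig(1)] h[OF sig(2)]
    by (simp only:) (intro quadratic_growth_mult quadratic_growth_const quadratic_growth_minus)
qed

section \<open>Coefficients of the block and summation over diagrams\<close>

lemma norm_square_diff_le:
  fixes a b :: complex
  shows "norm ((a + of_int m)\<^sup>2 - b\<^sup>2) \<le> (1 + norm a + norm b)\<^sup>2 * (1 + \<bar>of_int m\<bar>)\<^sup>2"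
proof -
  let ?R = "(1 + norm a + norm b) * (1 + \<bar>of_int m\<bar> :: real)"
  have *: "norm (a + of_int m + c) \<le> ?R" if "norm c = norm b" for c
  proof -
    have "norm (a + of_int m + c) \<le> norm a + \<bar>of_int m\<bar> + norm b"
      using norm_triangle_ineq[of "a + of_int m" c] norm_triangle_ineq[of a "of_int m"] that by simp
    also have "\<dots> \<le> ?R"
      by (simp add: algebra_simps)
    finally show ?thesis .
  qed
  have split: "(a + of_int m)\<^sup>2 - b\<^sup>2 = (a + of_int m + b) * (a + of_int m + - b)"
    by (simp add: power2_eq_square algebra_simps)
  have "norm ((a + of_int m)\<^sup>2 - b\<^sup>2) \<le> ?R * ?R"
    unfolding split norm_mult by (intro mult_mono *) auto
  then show ?thesis
    by (simp add: power2_eq_square mult_ac)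
qed

text \<open>The 2 in the constant comes from |h| \<ge> (1 + |h|) / 2 for a nonzero integer; for
  \<open>h = 0\<close> the quotient is 0 by the convention for division.\<close>

lemma norm_cell_factor_le:
  fixes a b a' b' w :: complex
  assumes d: "d > 0" "\<And>m::int. d * (1 + \<bar>of_int m\<bar>) \<le> norm (w + of_int m)"
  shows "norm (((a + of_int m)\<^sup>2 - b\<^sup>2) * ((a' + of_int m)\<^sup>2 - b'\<^sup>2) / ((of_int h)\<^sup>2 * (w + of_int e)\<^sup>2)) \<le>
    (2 * (1 + norm a + norm b) * (1 + norm a' + norm b') / d)\<^sup>2 *
    exp (4 * log_kernel m - 2 * log_kernel h - 2 * log_kernel e)"
proof (cases "h = 0")
  case False
  define H where "H = 1 + \<bar>real_of_int h\<bar>"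
  define E where "E = 1 + \<bar>real_of_int e\<bar>"
  define M where "M = 1 + \<bar>real_of_int m\<bar>"
  have pos: "H > 0" "E > 0" "M > 0"
    by (simp_all add: H_def E_def M_def add_pos_nonneg)
  have "\<bar>real_of_int h\<bar> \<ge> 1"
    using False by linarith
  then have "(H / 2)\<^sup>2 \<le> norm ((of_int h :: complex)\<^sup>2)"
    unfolding norm_power by (intro power_mono) (auto simp: H_def)
  moreover have "(d * E)\<^sup>2 \<le> norm ((w + of_int e)\<^sup>2)"
    unfolding norm_power using d pos by (intro power_mono) (auto simp: E_def)
  ultimately have den: "(H / 2)\<^sup>2 * (d * E)\<^sup>2 \<le> norm ((of_int h)\<^sup>2 * (w + of_int e)\<^sup>2)"
    unfolding norm_mult by (intro mult_mono) auto
  have num: "norm (((a + of_int m)\<^sup>2 - b\<^sup>2) * ((a' + of_int m)\<^sup>2 - b'\<^sup>2)) \<le>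
      ((1 + norm a + norm b)\<^sup>2 * M\<^sup>2) * ((1 + norm a' + norm b')\<^sup>2 * M\<^sup>2)"
    unfolding norm_mult M_def by (intro mult_mono norm_square_diff_le) auto
  have "norm (((a + of_int m)\<^sup>2 - b\<^sup>2) * ((a' + of_int m)\<^sup>2 - b'\<^sup>2) / ((of_int h)\<^sup>2 * (w + of_int e)\<^sup>2)) \<le>
      ((1 + norm a + norm b)\<^sup>2 * M\<^sup>2) * ((1 + norm a' + norm b')\<^sup>2 * M\<^sup>2) / ((H / 2)\<^sup>2 * (d * E)\<^sup>2)"
    unfolding norm_divide using num den d(1) pos by (intro frac_le) auto
  also have "\<dots> = (2 * (1 + norm a + norm b) * (1 + norm a' + norm b') / d)\<^sup>2 * (M ^ 4 / (H\<^sup>2 * E\<^sup>2))"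
    using d(1) pos by (simp add: field_simps power2_eq_square power4_eq_xxxx)
  also have "M ^ 4 / (H\<^sup>2 * E\<^sup>2) = exp (4 * log_kernel m - 2 * log_kernel h - 2 * log_kernel e)"
  proof -
    have "exp (4 * log_kernel m) = M ^ 4" "exp (2 * log_kernel h) = H\<^sup>2" "exp (2 * log_kernel e) = E\<^sup>2"
      using exp_of_nat_mult[of 4 "log_kernel m"] exp_of_nat_mult[of 2 "log_kernel h"]
        exp_of_nat_mult[of 2 "log_kernel e"]
      by (simp_all add: exp_log_kernel H_def E_def M_def)
    then show ?thesis
      by (simp add: exp_diff)
  qed
  finally show ?thesis .
qed simp

lemma norm_prod_exp_le:
  fixes f :: "'a \<Rightarrow> complex"
  assumes "\<And>x. x \<in> A \<Longrightarrow> norm (f x) \<le> K * exp (g x)" "finite A"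
  shows "norm (prod f A) \<le> K ^ card A * exp (sum g A)"
proof -
  have "norm (prod f A) \<le> (\<Prod>x\<in>A. K * exp (g x))"
    unfolding prod_norm[symmetric] using assms(1) by (intro prod_mono) auto
  then show ?thesis
    using assms(2) by (simp add: prod.distrib exp_sum)
qed

text \<open>Each linear factor is a fixed complex number plus an integer, and n enters through the
  integer only, so \<open>K\<close> is uniform in n. Numerators have weight 4 and denominators
  weight 2, which is twice the energy inequality; hence 8 n^2.\<close>

lemma norm_block_coeff_le:
  assumes "2 * \<sigma> \<notin> \<int>"
  obtains K where "K \<ge> 1"
    "\<And>n lam mu. lam \<in> young_diagrams \<Longrightarrow> mu \<in> young_diagrams \<Longrightarrow>
       norm (block_coeff \<theta>0 \<theta>t \<theta>1 \<theta>inf (\<sigma> + of_int n) lam mu) \<le>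
         K ^ (card lam + card mu) * exp (8 * (of_int n)\<^sup>2)"
proof -
  obtain d where d: "d > 0" "\<And>m::int. d * (1 + \<bar>of_int m\<bar>) \<le> norm (2 * \<sigma> + of_int m)"
    using Ints_distance_ge[OF assms] by blast
  have "- 2 * \<sigma> \<notin> \<int>"
    using assms by (metis Ints_minus minus_minus mult_minus_left)
  then obtain d' where d': "d' > 0" "\<And>m::int. d' * (1 + \<bar>of_int m\<bar>) \<le> norm (- 2 * \<sigma> + of_int m)"
    using Ints_distance_ge by blast
  define Kl where "Kl = (2 * (1 + norm (\<theta>t + \<sigma>) + norm \<theta>0) * (1 + norm (\<theta>1 + \<sigma>) + norm \<theta>inf) / d)\<^sup>2"
  define Km where "Km = (2 * (1 + norm (\<theta>t - \<sigma>) + norm \<theta>0) * (1 + norm (\<theta>1 - \<sigma>) + norm \<theta>inf) / d')\<^sup>2"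
  define K where "K = 1 + Kl + Km"
  have K: "0 \<le> Kl" "0 \<le> Km" "Kl \<le> K" "Km \<le> K" "1 \<le> K"
    by (auto simp: K_def Kl_def Km_def)
  show thesis
  proof (rule that[OF K(5)])
    fix n :: int and lam mu :: "(nat \<times> nat) set"
    assume lam: "lam \<in> young_diagrams" and mu: "mu \<in> young_diagrams"
    let ?K = log_kernel
    have fin: "finite lam" "finite mu"
      using lam mu by (auto intro: young_diagrams_finite)
    define f where "f = (\<lambda>(i, j).
       ((\<theta>t + (\<sigma> + of_int n) + of_nat i - of_nat j)\<^sup>2 - \<theta>0\<^sup>2) *
       ((\<theta>1 + (\<sigma> + of_int n) + of_nat i - of_nat j)\<^sup>2 - \<theta>inf\<^sup>2) /
       ((of_int (hook_length lam i j))\<^sup>2 *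
        (of_nat (row_length (conjugate lam) j) - of_nat i + of_nat (row_length mu i) - of_nat j
           + 1 + 2 * (\<sigma> + of_int n))\<^sup>2))"
    define g where "g = (\<lambda>(i, j).
       ((\<theta>t - (\<sigma> + of_int n) + of_nat i - of_nat j)\<^sup>2 - \<theta>0\<^sup>2) *
       ((\<theta>1 - (\<sigma> + of_int n) + of_nat i - of_nat j)\<^sup>2 - \<theta>inf\<^sup>2) /
       ((of_int (hook_length mu i j))\<^sup>2 *
        (of_nat (row_length (conjugate mu) j) - of_nat i + of_nat (row_length lam i) - of_nat j
           + 1 - 2 * (\<sigma> + of_int n))\<^sup>2))"
    define u where "u = (\<lambda>(i, j). 4 * ?K (n + cell_content (i, j)) - 2 * ?K (hook_length lam i j)
        - 2 * ?K (2 * n + arm_leg lam mu i j))"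
    define v where "v = (\<lambda>(i, j). 4 * ?K (cell_content (i, j) - n) - 2 * ?K (hook_length mu i j)
        - 2 * ?K (arm_leg mu lam i j - 2 * n))"
    have f_le: "norm (f x) \<le> Kl * exp (u x)" for x
    proof (cases x)
      case (Pair i j)
      have e: "\<theta>t + (\<sigma> + of_int n) + of_nat i - of_nat j = (\<theta>t + \<sigma>) + of_int (n + cell_content (i, j))"
        "\<theta>1 + (\<sigma> + of_int n) + of_nat i - of_nat j = (\<theta>1 + \<sigma>) + of_int (n + cell_content (i, j))"
        "of_nat (row_length (conjugate lam) j) - of_nat i + of_nat (row_length mu i) - of_nat j
           + 1 + 2 * (\<sigma> + of_int n) = 2 * \<sigma> + of_int (2 * n + arm_leg lam mu i j)"
        by (simp_all add: cell_content_def arm_leg_def algebra_simps)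
      show ?thesis
        unfolding Pair f_def u_def prod.case e Kl_def by (rule norm_cell_factor_le[OF d])
    qed
    have g_le: "norm (g x) \<le> Km * exp (v x)" for x
    proof (cases x)
      case (Pair i j)
      have e: "\<theta>t - (\<sigma> + of_int n) + of_nat i - of_nat j = (\<theta>t - \<sigma>) + of_int (cell_content (i, j) - n)"
        "\<theta>1 - (\<sigma> + of_int n) + of_nat i - of_nat j = (\<theta>1 - \<sigma>) + of_int (cell_content (i, j) - n)"
        "of_nat (row_length (conjugate mu) j) - of_nat i + of_nat (row_length lam i) - of_nat j
           + 1 - 2 * (\<sigma> + of_int n) = - 2 * \<sigma> + of_int (arm_leg mu lam i j - 2 * n)"
        by (simp_all add: cell_content_def arm_leg_def algebra_simps)
      show ?thesis
        unfolding Pair g_def v_def prod.case e Km_def by (rule norm_cell_factor_le[OF d'])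
    qed
    have "sum u lam + sum v mu =
        4 * (\<Sum>c\<in>lam. ?K (n + cell_content c)) + 4 * (\<Sum>c\<in>mu. ?K (cell_content c - n)) -
        2 * (\<Sum>(i, j)\<in>lam. ?K (hook_length lam i j) + ?K (2 * n + arm_leg lam mu i j)) -
        2 * (\<Sum>(i, j)\<in>mu. ?K (hook_length mu i j) + ?K (arm_leg mu lam i j - 2 * n))"
      by (simp add: u_def v_def case_prod_unfold sum.distrib sum_subtractf sum_distrib_left algebra_simps)
    then have uv: "sum u lam + sum v mu \<le> 8 * (of_int n)\<^sup>2"
      using arm_leg_log_energy[OF lam mu, of n] by argo
    have split: "block_coeff \<theta>0 \<theta>t \<theta>1 \<theta>inf (\<sigma> + of_int n) lam mu = prod f lam * prod g mu"
      unfolding block_coeff_def f_def g_def ..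
    have "norm (block_coeff \<theta>0 \<theta>t \<theta>1 \<theta>inf (\<sigma> + of_int n) lam mu) \<le>
        (Kl ^ card lam * exp (sum u lam)) * (Km ^ card mu * exp (sum v mu))"
      unfolding split norm_mult using K f_le g_le fin
      by (intro mult_mono norm_prod_exp_le) auto
    also have "\<dots> = (Kl ^ card lam * Km ^ card mu) * exp (sum u lam + sum v mu)"
      by (simp add: exp_add)
    also have "\<dots> \<le> (K ^ card lam * K ^ card mu) * exp (8 * (of_int n)\<^sup>2)"
      using K uv by (intro mult_mono power_mono) auto
    finally show "norm (block_coeff \<theta>0 \<theta>t \<theta>1 \<theta>inf (\<sigma> + of_int n) lam mu) \<le>
         K ^ (card lam + card mu) * exp (8 * (of_int n)\<^sup>2)"
      by (simp add: power_add)
  qed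
qed

section \<open>Counting Young diagrams\<close>

definition young_diagrams_of_size :: "nat \<Rightarrow> (nat \<times> nat) set set" where
  "young_diagrams_of_size N = {lam \<in> young_diagrams. card lam = N}"

definition prepend_row :: "nat \<Rightarrow> (nat \<times> nat) set \<Rightarrow> (nat \<times> nat) set" where
  "prepend_row k nu = {1} \<times> {1..k} \<union> (\<lambda>(i, j). (Suc i, j)) ` nu"

lemma young_diagrams_of_size_remove_row:
  assumes "lam \<in> young_diagrams_of_size (Suc N)"
  obtains k nu where "1 \<le> k" "k \<le> Suc N" "nu \<in> young_diagrams_of_size (Suc N - k)" "lam = prepend_row k nu"
proof -
  have lam: "lam \<in> young_diagrams" and card: "card lam = Suc N"
    using assms by (auto simp: young_diagrams_of_size_def)
  define k where "k = row_length lam 1"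
  define nu where "nu = {(i, j). (Suc i, j) \<in> lam \<and> 1 \<le> i}"
  let ?s = "\<lambda>(i::nat, j::nat). (Suc i, j)"
  have inj: "inj ?s"
    by (auto simp: inj_on_def)
  have "nu \<subseteq> ?s -` lam"
    by (auto simp: nu_def)
  then have fin: "finite nu"
    using finite_vimageI[OF young_diagrams_finite[OF lam] inj] finite_subset by blast
  have "nu \<in> young_diagrams"
  proof -
    have "{1..i} \<times> {1..j} \<subseteq> nu" if "(i, j) \<in> nu" for i j
      using that young_diagrams_down[OF lam, of "Suc i" j] by (auto simp: nu_def)
    moreover have "nu \<subseteq> {1..} \<times> {1..}"
      using young_diagrams_pos[OF lam] by (force simp: nu_def)
    ultimately show ?thesis
      using fin unfolding young_diagrams_def by blast
  qed
  have eq: "lam = prepend_row k nu"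
  proof (rule set_eqI)
    fix x :: "nat \<times> nat"
    obtain i j where x: "x = (i, j)"
      by (cases x)
    show "x \<in> lam \<longleftrightarrow> x \<in> prepend_row k nu"
    proof (cases "i \<le> 1")
      case True
      then show ?thesis
        using young_diagrams_pos[OF lam, of i j] in_young_diagram_row[OF lam, of 1 j]
        unfolding x by (cases "i = 1") (auto simp: prepend_row_def k_def nu_def)
    next
      case False
      then obtain i' where "i = Suc i'" "1 \<le> i'"
        by (cases i) auto
      then show ?thesis
        unfolding x by (force simp: prepend_row_def nu_def)
    qed
  qed
  have "card lam = card ({1 :: nat} \<times> {1..k}) + card (?s ` nu)"
    unfolding eq prepend_row_def using fin by (intro card_Un_disjoint) (auto simp: nu_def)
  then have sum: "Suc N = k + card nu"
    using card card_image[OF inj_on_subset[OF inj], of nu] by simp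
  obtain i j where ij: "(i, j) \<in> lam"
    using card by (metis card.empty ex_in_conv nat.distinct(1) surj_pair)
  then have "(1, 1) \<in> lam"
    using young_diagrams_down[OF lam ij, of 1 1] young_diagrams_pos[OF lam ij] by simp
  then have "1 \<le> k"
    by (simp add: k_def in_young_diagram_row[OF lam])
  then show thesis
    using that[of k nu] sum eq \<open>nu \<in> young_diagrams\<close> by (auto simp: young_diagrams_of_size_def)
qed

text \<open>Splitting off the first row and forgetting that the rows decrease amounts to counting
  compositions, whence the powers of 2.\<close>

lemma young_diagrams_of_size_bound:
  "finite (young_diagrams_of_size N) \<and> card (young_diagrams_of_size N) \<le> 2 ^ N"
proof (induction N rule: less_induct)
  case (less N)
  show ?case
  proof (cases N)
    case 0
    then have "young_diagrams_of_size N \<subseteq> {{}}"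
      by (auto simp: young_diagrams_of_size_def young_diagrams_finite)
    then show ?thesis
      using 0 card_mono[of "{{}}" "young_diagrams_of_size N"] finite_subset by fastforce
  next
    case (Suc M)
    define U where "U = (\<Union>m\<in>{..M}. prepend_row (Suc M - m) ` young_diagrams_of_size m)"
    have "young_diagrams_of_size N \<subseteq> U"
    proof
      fix lam assume "lam \<in> young_diagrams_of_size N"
      then obtain k nu where k: "1 \<le> k" "k \<le> Suc M" "nu \<in> young_diagrams_of_size (Suc M - k)"
        "lam = prepend_row k nu"
        using young_diagrams_of_size_remove_row Suc by blast
      then have "Suc M - k \<in> {..M}" "lam \<in> prepend_row (Suc M - (Suc M - k)) ` young_diagrams_of_size (Suc M - k)"
        by auto
      then show "lam \<in> U"
        unfolding U_def by blast
    qed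
    moreover have fin: "finite U"
      unfolding U_def using less Suc by auto
    ultimately have "finite (young_diagrams_of_size N)" "card (young_diagrams_of_size N) \<le> card U"
      by (auto intro: finite_subset card_mono)
    moreover have "card U \<le> (\<Sum>m\<le>M. card (prepend_row (Suc M - m) ` young_diagrams_of_size m))"
      unfolding U_def by (rule card_UN_le) simp
    moreover have "\<dots> \<le> (\<Sum>m\<le>M. 2 ^ m)"
      using less Suc by (intro sum_mono) (meson card_image_le le_imp_less_Suc order_trans atMost_iff)
    moreover have "(\<Sum>m\<le>M. 2 ^ m) \<le> (2 ^ N :: nat)"
      unfolding Suc by (induction M) auto
    ultimately show ?thesis
      by linarith
  qed
qed

lemma young_diagrams_power_summable:
  fixes y :: real
  assumes "0 \<le> y" "2 * y < 1"
  shows "(\<lambda>lam. y ^ card lam) summable_on young_diagrams"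
proof (rule nonneg_bdd_above_summable_on)
  show "bdd_above (sum (\<lambda>lam. y ^ card lam) ` {F. F \<subseteq> young_diagrams \<and> finite F})"
  proof (rule bdd_aboveI2)
    fix F assume "F \<in> {F. F \<subseteq> young_diagrams \<and> finite F}"
    then have F: "F \<subseteq> young_diagrams" "finite F"
      by auto
    have "(\<Sum>lam\<in>F. y ^ card lam) = (\<Sum>N\<in>card ` F. \<Sum>lam\<in>{lam\<in>F. card lam = N}. y ^ card lam)"
      by (rule sum.image_gen[OF F(2)])
    also have "\<dots> \<le> (\<Sum>N\<in>card ` F. (2 * y) ^ N)"
    proof (rule sum_mono)
      fix N
      have "card {lam\<in>F. card lam = N} \<le> card (young_diagrams_of_size N)"
        using young_diagrams_of_size_bound[of N] F(1)
        by (intro card_mono) (auto simp: young_diagrams_of_size_def)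
      also have "\<dots> \<le> 2 ^ N"
        using young_diagrams_of_size_bound by blast
      finally have "real (card {lam\<in>F. card lam = N}) * y ^ N \<le> 2 ^ N * y ^ N"
        using assms(1) by (intro mult_right_mono) (auto simp: numeral_power_le_of_nat_cancel_iff)
      then show "(\<Sum>lam\<in>{lam\<in>F. card lam = N}. y ^ card lam) \<le> (2 * y) ^ N"
        by (simp add: power_mult_distrib)
    qed
    also have "\<dots> \<le> (\<Sum>N. (2 * y) ^ N)"
      using assms F(2) by (intro sum_le_suminf summable_geometric) auto
    finally show "(\<Sum>lam\<in>F. y ^ card lam) \<le> (\<Sum>N. (2 * y) ^ N)" .
  qed
qed (use assms in simp)

section \<open>Absolute summability of the expanded tau series\<close>

lemma summable_on_times_nonneg:
  fixes f :: "'a \<Rightarrow> real" and g :: "'b \<Rightarrow> real"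
  assumes "f summable_on A" "g summable_on B"
    and "\<And>x. x \<in> A \<Longrightarrow> 0 \<le> f x" "\<And>y. y \<in> B \<Longrightarrow> 0 \<le> g y"
  shows "(\<lambda>(x, y). f x * g y) summable_on A \<times> B"
proof (rule summable_on_SigmaI)
  show "((\<lambda>y. case (x, y) of (x, y) \<Rightarrow> f x * g y) has_sum f x * infsum g B) B" if "x \<in> A" for x
    using has_sum_cmult_right[OF has_sum_infsum[OF assms(2)]] by simp
  show "(\<lambda>x. f x * infsum g B) summable_on A"
    using assms(1) by (rule summable_on_cmult_left)
qed (use assms in auto)

lemma exp_minus_abs_summable_on_int: "(\<lambda>n::int. exp (- \<bar>real_of_int n\<bar>)) summable_on UNIV"
proof -
  have nat: "(\<lambda>k::nat. exp (- real k)) summable_on UNIV"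
  proof (subst summable_on_UNIV_nonneg_real_iff)
    have "summable (\<lambda>k::nat. exp (- 1 :: real) ^ k)"
      by (rule summable_geometric) simp
    then show "summable (\<lambda>k::nat. exp (- real k))"
      by (simp add: exp_of_nat_mult[symmetric])
  qed simp
  have img: "(\<lambda>n::int. exp (- \<bar>real_of_int n\<bar>)) summable_on f ` UNIV"
    if "inj f" "\<And>k. \<bar>f k\<bar> = int k" for f :: "nat \<Rightarrow> int"
  proof -
    have "\<bar>real_of_int (f k)\<bar> = real k" for k
      using that(2)[of k] by (metis of_int_abs of_int_of_nat_eq)
    then show ?thesis
      using nat that(1) by (subst summable_on_reindex) (auto simp: o_def)
  qed
  have pos: "(\<lambda>n::int. exp (- \<bar>real_of_int n\<bar>)) summable_on range int"
    by (rule img) auto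
  have "(\<lambda>n::int. exp (- \<bar>real_of_int n\<bar>)) summable_on range (\<lambda>k. - int k)"
    by (rule img) (auto simp: inj_on_def)
  moreover have "n \<in> range (\<lambda>k. - int k)" if "n < 0" for n
    using that by (intro range_eqI[of _ _ "nat (- n)"]) simp
  ultimately have neg: "(\<lambda>n::int. exp (- \<bar>real_of_int n\<bar>)) summable_on {..<0}"
    by (blast intro: summable_on_subset_banach)
  have "range int \<union> {..<0} = UNIV"
    by (metis Un_UNIV_left UNIV_eq_I UnI1 UnI2 lessThan_iff linorder_not_less rangeI zero_le_imp_eq_int)
  then show ?thesis
    using summable_on_Un_disjoint[OF pos neg] by force
qed

text \<open>The coefficient of n^2 in the real part of the exponent is \<open>Re L\<close>. The
  imaginary part of \<open>L\<close> affects only terms at most linear in |n|, so one disc serves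
  all branches.\<close>

lemma norm_exp_square_le:
  fixes s L :: complex
  shows "norm (exp ((s + of_int n)\<^sup>2 * L)) \<le>
    exp ((norm s)\<^sup>2 * norm L) * exp (2 * norm s * norm L * \<bar>of_int n\<bar>) * exp ((of_int n)\<^sup>2 * Re L)"
proof -
  have "(s + of_int n)\<^sup>2 * L = s\<^sup>2 * L + 2 * s * L * of_int n + of_real ((of_int n)\<^sup>2) * L"
    by (simp add: power2_eq_square algebra_simps)
  moreover have "Re (of_real x * L) = x * Re L" for x
    by simp
  ultimately have "Re ((s + of_int n)\<^sup>2 * L) = Re (s\<^sup>2 * L) + Re (2 * s * L * of_int n) + (of_int n)\<^sup>2 * Re L"
    by (simp only: plus_complex.sel)
  also have "\<dots> \<le> (norm s)\<^sup>2 * norm L + 2 * norm s * norm L * \<bar>of_int n\<bar> + (of_int n)\<^sup>2 * Re L"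
    using complex_Re_le_cmod[of "s\<^sup>2 * L"] complex_Re_le_cmod[of "2 * s * L * of_int n"]
    by (simp add: norm_mult norm_power)
  finally show ?thesis
    by (simp add: exp_add[symmetric])
qed

lemma norm_tau_expanded_term_le:
  fixes \<theta>0 \<theta>t \<theta>1 \<theta>inf \<sigma> \<eta> \<kappa> L :: complex
  assumes coeff: "norm (block_coeff \<theta>0 \<theta>t \<theta>1 \<theta>inf (\<sigma> + of_int n) lam mu) \<le>
      K ^ (card lam + card mu) * exp (8 * (of_int n)\<^sup>2)"
    and struct: "norm (structure_const \<theta>1 \<theta>inf (\<sigma> + of_int n) * structure_const \<theta>t (\<sigma> + of_int n) \<theta>0)
      \<le> exp (C * (1 + (of_int n)\<^sup>2))"
    and L: "C + 8 + Re L \<le> - 1" and K: "0 \<le> K"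
  defines "\<beta> \<equiv> norm \<eta> + 2 * norm \<sigma> * norm L"
  shows "norm (tau_expanded_term \<kappa> \<theta>0 \<theta>t \<theta>1 \<theta>inf \<sigma> \<eta> L (n, lam, mu)) \<le>
    norm (\<kappa> * exp ((- \<theta>0\<^sup>2 - \<theta>t\<^sup>2) * L)) * norm ((1 - exp L) powr (2 * \<theta>t * \<theta>1)) *
      exp (C + (norm \<sigma>)\<^sup>2 * norm L + (\<beta> + 1)\<^sup>2) * exp (- \<bar>of_int n\<bar>) *
      ((K * norm (exp L)) ^ card lam * (K * norm (exp L)) ^ card mu)"
proof -
  let ?A = "norm (\<kappa> * exp ((- \<theta>0\<^sup>2 - \<theta>t\<^sup>2) * L))" and ?P = "norm ((1 - exp L) powr (2 * \<theta>t * \<theta>1))"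
  let ?m = "card lam + card mu" and ?n = "real_of_int n"
  have eta: "norm (exp (\<i> * of_int n * \<eta>)) \<le> exp (norm \<eta> * \<bar>?n\<bar>)"
    using complex_Re_le_cmod[of "\<i> * of_int n * \<eta>"] by (simp add: norm_mult mult.commute)
  have "norm (tau_expanded_term \<kappa> \<theta>0 \<theta>t \<theta>1 \<theta>inf \<sigma> \<eta> L (n, lam, mu)) =
      ?A * ?P * (norm (exp (\<i> * of_int n * \<eta>)) *
      norm (structure_const \<theta>1 \<theta>inf (\<sigma> + of_int n) * structure_const \<theta>t (\<sigma> + of_int n) \<theta>0) *
      norm (exp ((\<sigma> + of_int n)\<^sup>2 * L)) *
      (norm (block_coeff \<theta>0 \<theta>t \<theta>1 \<theta>inf (\<sigma> + of_int n) lam mu) * norm (exp L) ^ ?m))"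
    unfolding tau_expanded_term_def tau_factor_def block_prefactor_def block_series_term_def
    by (simp only: prod.case norm_mult norm_power mult_ac)
  also have "\<dots> \<le> ?A * ?P * (exp (norm \<eta> * \<bar>?n\<bar>) * exp (C * (1 + ?n\<^sup>2)) *
      (exp ((norm \<sigma>)\<^sup>2 * norm L) * exp (2 * norm \<sigma> * norm L * \<bar>?n\<bar>) * exp (?n\<^sup>2 * Re L)) *
      ((K ^ ?m * exp (8 * ?n\<^sup>2)) * norm (exp L) ^ ?m))"
    by (intro mult_left_mono mult_mono eta struct coeff norm_exp_square_le mult_right_mono
        mult_nonneg_nonneg norm_ge_zero zero_le_power order.refl exp_ge_zero)
       (use K in auto)
  also have "\<dots> = ?A * ?P * exp (C + (norm \<sigma>)\<^sup>2 * norm L + (\<beta> * \<bar>?n\<bar> + ?n\<^sup>2 * (C + 8 + Re L))) *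
      ((K * norm (exp L)) ^ card lam * (K * norm (exp L)) ^ card mu)"
  proof -
    have "C + (norm \<sigma>)\<^sup>2 * norm L + (\<beta> * \<bar>?n\<bar> + ?n\<^sup>2 * (C + 8 + Re L)) =
      norm \<eta> * \<bar>?n\<bar> + C * (1 + ?n\<^sup>2) + ((norm \<sigma>)\<^sup>2 * norm L + 2 * norm \<sigma> * norm L * \<bar>?n\<bar> + ?n\<^sup>2 * Re L) + 8 * ?n\<^sup>2"
      by (simp add: \<beta>_def algebra_simps)
    then show ?thesis
      by (simp only: exp_add power_add power_mult_distrib mult_ac)
  qed
  also have "\<dots> \<le> ?A * ?P * exp (C + (norm \<sigma>)\<^sup>2 * norm L + ((\<beta> + 1)\<^sup>2 - \<bar>?n\<bar>)) *
      ((K * norm (exp L)) ^ card lam * (K * norm (exp L)) ^ card mu)"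
  proof -
    have "?n\<^sup>2 * (C + 8 + Re L) \<le> ?n\<^sup>2 * (- 1)"
      using L by (intro mult_left_mono) auto
    \<comment> \<open>A quarter of the Gaussian decay absorbs the linear growth. The additional |n|
      on the left is what later becomes the summable factor exp (- |n|).\<close>
    moreover have "\<beta> * \<bar>?n\<bar> + \<bar>?n\<bar> \<le> (\<beta> + 1)\<^sup>2 + ?n\<^sup>2 / 4"
      using zero_le_power2[of "(\<beta> + 1) - \<bar>?n\<bar> / 2"] by (simp add: power2_eq_square algebra_simps)
    moreover have "?n\<^sup>2 / 4 \<le> ?n\<^sup>2"
      by simp
    ultimately have "\<beta> * \<bar>?n\<bar> + ?n\<^sup>2 * (C + 8 + Re L) \<le> (\<beta> + 1)\<^sup>2 - \<bar>?n\<bar>"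
      by linarith
    moreover have "0 \<le> (K * norm (exp L)) ^ card lam * (K * norm (exp L)) ^ card mu"
      using K by simp
    ultimately show ?thesis
      by (intro mult_right_mono mult_left_mono) auto
  qed
  also have "exp (C + (norm \<sigma>)\<^sup>2 * norm L + ((\<beta> + 1)\<^sup>2 - \<bar>?n\<bar>)) =
      exp (C + (norm \<sigma>)\<^sup>2 * norm L + (\<beta> + 1)\<^sup>2) * exp (- \<bar>?n\<bar>)"
    by (simp add: exp_add[symmetric])
  finally show ?thesis
    by (simp only: mult_ac)
qed

theorem mainTheorem4:
  fixes \<theta>0 \<theta>t \<theta>1 \<theta>inf \<sigma> \<eta> \<kappa> :: complex
  assumes "\<sigma> \<notin> \<rat>"
    and "\<bar>Re \<sigma>\<bar> \<notin> {1 / 2 + of_int k | k :: int. True}"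
  shows "\<exists>D :: complex set.
    open D \<and> connected D \<and> 0 \<notin> D \<and> (\<exists>r>0. ball 0 r - {0} \<subseteq> D) \<and>
    (\<forall>L. exp L \<in> D \<longrightarrow>
       (\<lambda>x. norm (tau_expanded_term \<kappa> \<theta>0 \<theta>t \<theta>1 \<theta>inf \<sigma> \<eta> L x))
         summable_on (UNIV \<times> young_diagrams \<times> young_diagrams) \<and>
       (\<lambda>n. norm (tau_term \<kappa> \<theta>0 \<theta>t \<theta>1 \<theta>inf \<sigma> \<eta> L n)) summable_on UNIV \<and>
       block_series_term \<theta>0 \<theta>t \<theta>1 \<theta>inf \<sigma> L
         summable_on (young_diagrams \<times> young_diagrams))"
proof -
  have sigma: "2 * \<sigma> \<notin> \<int>"
  proof
    assume "2 * \<sigma> \<in> \<int>"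
    then have "2 * \<sigma> / 2 \<in> \<rat>"
      by (intro Rats_divide) (auto elim: Ints_cases)
    then show False
      using assms(1) by simp
  qed
  obtain K where K: "K \<ge> 1"
    "\<And>n lam mu. lam \<in> young_diagrams \<Longrightarrow> mu \<in> young_diagrams \<Longrightarrow>
       norm (block_coeff \<theta>0 \<theta>t \<theta>1 \<theta>inf (\<sigma> + of_int n) lam mu) \<le>
         K ^ (card lam + card mu) * exp (8 * (of_int n)\<^sup>2)"
    using norm_block_coeff_le[OF sigma] by blast
  obtain C where C: "\<And>n. norm (structure_const \<theta>1 \<theta>inf (\<sigma> + of_int n) * structure_const \<theta>t (\<sigma> + of_int n) \<theta>0)
      \<le> exp (C * (1 + (of_int n)\<^sup>2))"
    using quadratic_growth_structure_const[OF sigma] unfolding quadratic_growth_def by blast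
  \<comment> \<open>The first bound makes the total coefficient of n^2 at most - 1. The second gives
    K |t| < 1/2, which beats the 2^N diagrams of size N.\<close>
  define r where "r = min (exp (- (C + 9))) (1 / (2 * K))"
  define D where "D = ball (0 :: complex) r - {0}"
  have r: "r > 0"
    using K(1) by (simp add: r_def)
  have summable: "(\<lambda>x. norm (tau_expanded_term \<kappa> \<theta>0 \<theta>t \<theta>1 \<theta>inf \<sigma> \<eta> L x))
         summable_on (UNIV \<times> young_diagrams \<times> young_diagrams) \<and>
       (\<lambda>n. norm (tau_term \<kappa> \<theta>0 \<theta>t \<theta>1 \<theta>inf \<sigma> \<eta> L n)) summable_on UNIV \<and>
       block_series_term \<theta>0 \<theta>t \<theta>1 \<theta>inf \<sigma> L summable_on (young_diagrams \<times> young_diagrams)"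
    if "exp L \<in> D" for L
  proof -
    let ?Y = "young_diagrams \<times> young_diagrams"
    let ?t = "tau_expanded_term \<kappa> \<theta>0 \<theta>t \<theta>1 \<theta>inf \<sigma> \<eta> L"
    define y where "y = K * norm (exp L)"
    have "norm (exp L) < r"
      using that by (simp add: D_def)
    then have "exp (Re L) < exp (- (C + 9))" "norm (exp L) < 1 / (2 * K)"
      by (simp_all add: r_def)
    then have ReL: "C + 8 + Re L \<le> - 1" and y: "0 \<le> y" "2 * y < 1"
      using K(1) by (simp_all add: y_def field_simps)
    define B where "B = norm (\<kappa> * exp ((- \<theta>0\<^sup>2 - \<theta>t\<^sup>2) * L)) * norm ((1 - exp L) powr (2 * \<theta>t * \<theta>1)) *
      exp (C + (norm \<sigma>)\<^sup>2 * norm L + (norm \<eta> + 2 * norm \<sigma> * norm L + 1)\<^sup>2)"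
    have B: "0 \<le> B"
      by (simp add: B_def)
    have diagrams: "(\<lambda>(lam, mu). y ^ card lam * y ^ card mu) summable_on ?Y"
      using y by (intro summable_on_times_nonneg young_diagrams_power_summable) auto
    have "(\<lambda>(n, p). B * exp (- \<bar>real_of_int n\<bar>) * (case p of (lam, mu) \<Rightarrow> y ^ card lam * y ^ card mu))
        summable_on UNIV \<times> ?Y"
      using y B
      by (intro summable_on_times_nonneg summable_on_cmult_right exp_minus_abs_summable_on_int diagrams) auto
    then have expanded: "(\<lambda>x. norm (?t x)) summable_on (UNIV \<times> ?Y)"
    proof (rule Infinite_Sum.abs_summable_on_comparison_test')
      fix x :: "int \<times> (nat \<times> nat) set \<times> (nat \<times> nat) set"
      assume "x \<in> UNIV \<times> ?Y"
      then obtain n lam mu where x: "x = (n, lam, mu)" "lam \<in> young_diagrams" "mu \<in> young_diagrams"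
        by auto
      show "norm (?t x) \<le> (case x of (n, p) \<Rightarrow>
          B * exp (- \<bar>real_of_int n\<bar>) * (case p of (lam, mu) \<Rightarrow> y ^ card lam * y ^ card mu))"
        using norm_tau_expanded_term_le[OF K(2)[OF x(2,3)] C ReL] K(1) by (simp add: x(1) B_def y_def)
    qed
    have rows: "(\<lambda>p. norm (?t (n, p))) summable_on ?Y" for n
      using summable_on_SigmaD1[of "\<lambda>n p. norm (?t (n, p))" UNIV "\<lambda>_. ?Y" n] expanded
      by (simp add: case_prod_unfold)
    have "(\<lambda>n. infsum (\<lambda>p. norm (?t (n, p))) ?Y) summable_on UNIV"
      using summable_on_SigmaD[OF expanded rows] by simp
    moreover have "norm (tau_term \<kappa> \<theta>0 \<theta>t \<theta>1 \<theta>inf \<sigma> \<eta> L n) \<le> infsum (\<lambda>p. norm (?t (n, p))) ?Y" for n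
    proof -
      have "tau_term \<kappa> \<theta>0 \<theta>t \<theta>1 \<theta>inf \<sigma> \<eta> L n = infsum (\<lambda>p. ?t (n, p)) ?Y"
        by (simp add: tau_term_def tau_expanded_term_def conformal_block_def infsum_cmult_right')
      then show ?thesis
        using norm_infsum_bound[OF rows[of n]] by simp
    qed
    ultimately have "(\<lambda>n. norm (tau_term \<kappa> \<theta>0 \<theta>t \<theta>1 \<theta>inf \<sigma> \<eta> L n)) summable_on UNIV"
      by (rule Infinite_Sum.abs_summable_on_comparison_test')
    \<comment> \<open>The coefficient bound at n = 0 is used directly. Dividing the n = 0 part of
      the expanded series by its prefactor would fail when \<kappa> or a structure constant
      vanishes.\<close>
    moreover have "norm (block_series_term \<theta>0 \<theta>t \<theta>1 \<theta>inf \<sigma> L p) \<le> (case p of (lam, mu) \<Rightarrow> y ^ card lam * y ^ card mu)"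
      if "p \<in> ?Y" for p
    proof -
      obtain lam mu where p: "p = (lam, mu)" "lam \<in> young_diagrams" "mu \<in> young_diagrams"
        using \<open>p \<in> ?Y\<close> by blast
      have "norm (block_coeff \<theta>0 \<theta>t \<theta>1 \<theta>inf \<sigma> lam mu) * norm (exp L) ^ (card lam + card mu) \<le>
          K ^ (card lam + card mu) * norm (exp L) ^ (card lam + card mu)"
        using K(2)[OF p(2,3), of 0] by (intro mult_right_mono) auto
      then show ?thesis
        by (simp add: p(1) block_series_term_def norm_mult norm_power y_def power_mult_distrib power_add mult_ac)
    qed
    then have "block_series_term \<theta>0 \<theta>t \<theta>1 \<theta>inf \<sigma> L summable_on ?Y"
      by (rule abs_summable_summable[OF Infinite_Sum.abs_summable_on_comparison_test'[OF diagrams]])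
    ultimately show ?thesis
      using expanded by blast
  qed
  have "open D" "connected D"
    unfolding D_def by (auto intro: connected_open_delete)
  then show ?thesis
    using r summable by (intro exI[of _ D]) (auto simp: D_def)
qed

end
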